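(* Let $\theta_0,\theta_1,\theta_t,\theta_\infty\in\mathbb{C}$ and let $\Theta_0,\Theta_1,\Theta_t,\Theta_\infty\in\mathbb{C}(q)$ be rational functions such that $\Theta_i(q)=1+(q-1)\frac{\theta_i}{2}+O((q-1)^2)$ as $q\to1$ for $i\in\{0,1,t,\infty\}$; put $\overline\Theta_i=1/\Theta_i$. Then the $q$-Schlesinger equations discretize the (differential) Schlesinger equations. That is, the right-hand sides $f_0,f_1,f_t$ (defined in the context) of the $q$-Schlesinger equations $$\partial_{q,t}\widetilde{\mathfrak{A}}_0=f_0(\widetilde{\mathfrak{A}}_0,\widetilde{\mathfrak{A}}_1,t,q),\quad\partial_{q,t}\widetilde{\mathfrak{A}}_1=f_1(\widetilde{\mathfrak{A}}_0,\widetilde{\mathfrak{A}}_1,t,q),\quad\partial_{q,t}\widetilde{\mathfrak{A}}_t=f_t(\widetilde{\mathfrak{A}}_0,\widetilde{\mathfrak{A}}_1,t,q)$$ satisfy, as $q\to1$, $$f_0=\frac{[\widetilde{\mathfrak{A}}_0,\widetilde{\mathfrak{A}}_t]}{0-t}+O(q-1),\qquad f_1=\frac{[\widetilde{\mathfrak{A}}_1,\widetilde{\mathfrak{A}}_t]}{1-t}+O(q-1),\qquad f_t=-\frac{[\widetilde{\mathfrak{A}}_0,\widetilde{\mathfrak{A}}_t]}{0-t}-\frac{[\widetilde{\mathfrak{A}}_1,\widetilde{\mathfrak{A}}_t]}{1-t}+O(q-1),$$ so that at $q=1$ one obtains the right-hand sides of the Schlesinger equations $A_0'=\frac{[A_0,A_t]}{0-t}$,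 $A_1'=\frac{[A_1,A_t]}{1-t}$, $A_t'=-\frac{[A_0,A_t]}{0-t}-\frac{[A_1,A_t]}{1-t}$.
   Context: $I_2$ is the $2\times2$ identity matrix; $\partial_{q,t}f(t)=\frac{f(qt)-f(t)}{(q-1)t}$; $[M,N]=MN-NM$. The matrices $\widetilde{\mathfrak{A}}_0,\widetilde{\mathfrak{A}}_1$ are $2\times2$ matrix variables and $t,q$ are scalar variables. Put $$\widetilde{\mathfrak{A}}_\infty=\mathrm{diag}\left(\frac{1-\overline\Theta_\infty}{q-1},\frac{1-\Theta_\infty}{q-1}\right),\qquad\widetilde{\mathfrak{A}}_t:=-(\widetilde{\mathfrak{A}}_0+\widetilde{\mathfrak{A}}_1+\widetilde{\mathfrak{A}}_\infty),$$ $$B_0=-qt\left(I_2+(q-1)\left(\frac{t-1}{(t\Theta_t-1)(t\overline\Theta_t-1)}\widetilde{\mathfrak{A}}_1-\widetilde{\mathfrak{A}}_\infty\right)\right)\left(I_2+(q-1)\left(\widetilde{\mathfrak{A}}_0+\frac{t(t-1)}{(t\Theta_t-1)(t\overline\Theta_t-1)}\widetilde{\mathfrak{A}}_1\right)\right)^{-1}.$$ (These come from $\widetilde{\mathfrak{A}}_0=\frac{\mathfrak{A}_0-I_2}{q-1}$, $\widetilde{\mathfrak{A}}_1=\frac{\mathfrak{A}_1}{q-1}$, $\widetilde{\mathfrak{A}}_t=\frac{\mathfrak{A}_t}{t(q-1)}$ for a $q$-Fuchsian system $\sigma_{q,x}Y=(\mathfrak{A}_0+\frac{x\mathfrak{A}_1}{x-1}+\frac{x\mathfrak{A}_t}{t(x-t)})Y$.)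 The right-hand sides of the $q$-Schlesinger equations, as matrix functions rational in the entries of $\widetilde{\mathfrak{A}}_0,\widetilde{\mathfrak{A}}_1$ and in $t,q$, considered where they are defined (with $t\neq0,1$ and $q\ne1$), are $$f_0=\frac{B_0\widetilde{\mathfrak{A}}_0B_0^{-1}-\widetilde{\mathfrak{A}}_0}{(q-1)t},$$ $$f_1=\frac{1}{(q-1)t}\left(\frac{t-1}{qt-1}\cdot\frac{(qt\Theta_t-1)(qt\overline\Theta_t-1)}{q(t\Theta_t-1)(t\overline\Theta_t-1)}(qI_2+B_0)\widetilde{\mathfrak{A}}_1(I_2+B_0)^{-1}-\widetilde{\mathfrak{A}}_1\right),$$ $$f_t=-\frac{1}{(q-1)^2t}\left(I_2+\frac{1}{qt\Theta_t\overline\Theta_t}B_0\right)-\frac{1}{(q-1)t}\left(B_0\widetilde{\mathfrak{A}}_0\left(\frac{1}{qt\Theta_t\overline\Theta_t}I_2+B_0^{-1}\right)+\widetilde{\mathfrak{A}}_t\right)$$ $$\qquad-\frac{(t-1)(qI_2+B_0)\widetilde{\mathfrak{A}}_1}{q(q-1)t(t\Theta_t-1)(t\overline\Theta_t-1)}\left(I_2+\frac{(qt\Theta_t-1)(qt\overline\Theta_t-1)}{qt-1}(I_2+B_0)^{-1}\right).$$ The $O(q-1)$ estimates are for fixed $\widetilde{\mathfrak{A}}_0,\widetilde{\mathfrak{A}}_1$ and fixed $t\ne0,1$. A system of $q$-difference equations $\partial_{q,t}g=f(g,t,q)$ with $f$ rational discretizes $\partial_tg=f(g,t,1)$ if $\{q=1\}$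 is not contained in the polar divisor of $f$. *)

theory Defs
  imports
    "HOL-Analysis.Analysis"
    "HOL-Library.Landau_Symbols"
    "HOL-Computational_Algebra.Field_as_Ring"
    "HOL-Computational_Algebra.Polynomial_Factorial"
    "HOL-Computational_Algebra.Normalized_Fraction"
begin

type_synonym mat2 = "complex ^ 2 ^ 2"

definition smult_mat :: "complex \<Rightarrow> mat2 \<Rightarrow> mat2" (infixr "*\<^sub>m" 75) where
  "c *\<^sub>m M = (\<chi> i j. c * M $ i $ j)"

definition diag2 :: "complex \<Rightarrow> complex \<Rightarrow> mat2" where
  "diag2 a b = vector [vector [a, 0], vector [0, b]]"

definition commutator :: "mat2 \<Rightarrow> mat2 \<Rightarrow> mat2" where
  "commutator M N = M ** N - N ** M"

text \<open>
  Elements of the field of rational functions in \<open>q\<close> are evaluated through their reduced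
  fraction; at a pole the value is the junk value \<open>0\<close>.
\<close>

definition rat_eval :: "complex poly fract \<Rightarrow> complex \<Rightarrow> complex" where
  "rat_eval r q = poly (fst (quot_of_fract r)) q / poly (snd (quot_of_fract r)) q"


section \<open>Right-hand sides of the q-Schlesinger equations\<close>

text \<open>
  The arguments \<open>\<Theta>t\<close> and \<open>\<Theta>inf\<close> are rational functions of \<open>q\<close>; their inverses are
  taken in the field of rational functions.
\<close>

definition qA_inf :: "complex poly fract \<Rightarrow> complex \<Rightarrow> mat2" where
  "qA_inf \<Theta>inf q =
     diag2 ((1 - rat_eval (inverse \<Theta>inf) q) / (q - 1)) ((1 - rat_eval \<Theta>inf q) / (q - 1))"

definition qA_t :: "complex poly fract \<Rightarrow> mat2 \<Rightarrow> mat2 \<Rightarrow> complex \<Rightarrow> mat2" where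
  "qA_t \<Theta>inf A0 A1 q = - (A0 + A1 + qA_inf \<Theta>inf q)"

text \<open>The factor \<open>(s \<Theta>t - 1) (s / \<Theta>t - 1)\<close>, needed at \<open>s = t\<close> and at \<open>s = q t\<close>.\<close>

definition qquad :: "complex poly fract \<Rightarrow> complex \<Rightarrow> complex \<Rightarrow> complex" where
  "qquad \<Theta>t s q = (s * rat_eval \<Theta>t q - 1) * (s * rat_eval (inverse \<Theta>t) q - 1)"

definition B0 :: "complex poly fract \<Rightarrow> complex poly fract \<Rightarrow> mat2 \<Rightarrow> mat2 \<Rightarrow> complex \<Rightarrow> complex \<Rightarrow> mat2" where
  "B0 \<Theta>t \<Theta>inf A0 A1 t q =
     (- (q * t)) *\<^sub>m
       ((mat 1 + (q - 1) *\<^sub>m (((t - 1) / qquad \<Theta>t t q) *\<^sub>m A1 - qA_inf \<Theta>inf q))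
        ** matrix_inv (mat 1 + (q - 1) *\<^sub>m (A0 + (t * (t - 1) / qquad \<Theta>t t q) *\<^sub>m A1)))"

definition qschlesinger_0 ::
  "complex poly fract \<Rightarrow> complex poly fract \<Rightarrow> mat2 \<Rightarrow> mat2 \<Rightarrow> complex \<Rightarrow> complex \<Rightarrow> mat2" where
  "qschlesinger_0 \<Theta>t \<Theta>inf A0 A1 t q =
     (let B = B0 \<Theta>t \<Theta>inf A0 A1 t q in
        (1 / ((q - 1) * t)) *\<^sub>m (B ** A0 ** matrix_inv B - A0))"

definition qschlesinger_1 ::
  "complex poly fract \<Rightarrow> complex poly fract \<Rightarrow> mat2 \<Rightarrow> mat2 \<Rightarrow> complex \<Rightarrow> complex \<Rightarrow> mat2" where
  "qschlesinger_1 \<Theta>t \<Theta>inf A0 A1 t q =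
     (let B = B0 \<Theta>t \<Theta>inf A0 A1 t q in
        (1 / ((q - 1) * t)) *\<^sub>m
          (((t - 1) / (q * t - 1) * (qquad \<Theta>t (q * t) q / (q * qquad \<Theta>t t q))) *\<^sub>m
             ((mat q + B) ** A1 ** matrix_inv (mat 1 + B))
           - A1))"

definition qschlesinger_t ::
  "complex poly fract \<Rightarrow> complex poly fract \<Rightarrow> mat2 \<Rightarrow> mat2 \<Rightarrow> complex \<Rightarrow> complex \<Rightarrow> mat2" where
  "qschlesinger_t \<Theta>t \<Theta>inf A0 A1 t q =
     (let B = B0 \<Theta>t \<Theta>inf A0 A1 t q;
          c = 1 / (q * t * rat_eval \<Theta>t q * rat_eval (inverse \<Theta>t) q) in
        - ((1 / ((q - 1)^2 * t)) *\<^sub>m (mat 1 + c *\<^sub>m B))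
        - (1 / ((q - 1) * t)) *\<^sub>m (B ** A0 ** (mat c + matrix_inv B) + qA_t \<Theta>inf A0 A1 q)
        - ((t - 1) / (q * (q - 1) * t * qquad \<Theta>t t q)) *\<^sub>m
            ((mat q + B) ** A1 **
             (mat 1 + (qquad \<Theta>t (q * t) q / (q * t - 1)) *\<^sub>m matrix_inv (mat 1 + B))))"


section \<open>Right-hand sides of the Schlesinger equations\<close>

definition schlesinger_0 :: "mat2 \<Rightarrow> mat2 \<Rightarrow> complex \<Rightarrow> mat2" where
  "schlesinger_0 A0 At t = (1 / (0 - t)) *\<^sub>m commutator A0 At"

definition schlesinger_1 :: "mat2 \<Rightarrow> mat2 \<Rightarrow> complex \<Rightarrow> mat2" where
  "schlesinger_1 A1 At t = (1 / (1 - t)) *\<^sub>m commutator A1 At"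

definition schlesinger_t :: "mat2 \<Rightarrow> mat2 \<Rightarrow> mat2 \<Rightarrow> complex \<Rightarrow> mat2" where
  "schlesinger_t A0 A1 At t =
     - ((1 / (0 - t)) *\<^sub>m commutator A0 At) - (1 / (1 - t)) *\<^sub>m commutator A1 At"


section \<open>Rational functions, polar loci and discretization\<close>

text \<open>A point consists of the two matrices, \<open>t\<close> and \<open>q\<close>, i.e. ten complex coordinates.\<close>

type_synonym point = "mat2 \<times> mat2 \<times> complex \<times> complex"

inductive polyfun :: "(point \<Rightarrow> complex) \<Rightarrow> bool" where
  polyfun_const: "polyfun (\<lambda>_. c)"
| polyfun_A0: "polyfun (\<lambda>(A0, A1, t, q). A0 $ i $ j)"
| polyfun_A1: "polyfun (\<lambda>(A0, A1, t, q). A1 $ i $ j)"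
| polyfun_t: "polyfun (\<lambda>(A0, A1, t, q). t)"
| polyfun_q: "polyfun (\<lambda>(A0, A1, t, q). q)"
| polyfun_add: "polyfun F \<Longrightarrow> polyfun G \<Longrightarrow> polyfun (\<lambda>p. F p + G p)"
| polyfun_mult: "polyfun F \<Longrightarrow> polyfun G \<Longrightarrow> polyfun (\<lambda>p. F p * G p)"

text \<open>
  \<open>F = N / D\<close> as rational functions: the two sides agree on a nonempty Zariski open set on which
  \<open>D\<close> does not vanish.  Values of the HOL function \<open>F\<close> at points where its defining formula
  makes no sense therefore play no role.
\<close>

definition represents :: "(point \<Rightarrow> complex) \<Rightarrow> (point \<Rightarrow> complex) \<Rightarrow> (point \<Rightarrow> complex) \<Rightarrow> bool" where
  "represents N D F \<longleftrightarrow> polyfun N \<and> polyfun D \<and>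
     (\<exists>E. polyfun E \<and> (\<exists>p. E p \<noteq> 0) \<and> (\<forall>p. E p \<noteq> 0 \<longrightarrow> D p \<noteq> 0 \<and> F p = N p / D p))"

definition rational_fun :: "(point \<Rightarrow> complex) \<Rightarrow> bool" where
  "rational_fun F \<longleftrightarrow> (\<exists>N D. represents N D F)"

text \<open>
  Support of the polar divisor: the points at which no representation as a fraction has a
  nonvanishing denominator, i.e. at which the rational function is not regular.
\<close>

definition polar_locus :: "(point \<Rightarrow> complex) \<Rightarrow> point set" where
  "polar_locus F = {p. \<forall>N D. represents N D F \<longrightarrow> D p = 0}"

text \<open>
  The system of q-difference equations with right-hand sides \<open>f k\<close> discretizes the system of
  differential equations with right-hand sides \<open>h k\<close>: \<open>f\<close> is rational, \<open>{q = 1}\<close> is not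
  contained in its polar divisor, and \<open>h\<close> is the restriction of the rational function \<open>f\<close> to
  \<open>q = 1\<close>.  As \<open>f\<close> is considered for \<open>t \<noteq> 0, 1\<close> only, so is the restriction.
\<close>

definition discretizes ::
  "('k \<Rightarrow> mat2 \<Rightarrow> mat2 \<Rightarrow> complex \<Rightarrow> complex \<Rightarrow> mat2) \<Rightarrow> ('k \<Rightarrow> mat2 \<Rightarrow> mat2 \<Rightarrow> complex \<Rightarrow> mat2) \<Rightarrow> bool" where
  "discretizes f h \<longleftrightarrow>
     (let F = (\<lambda>k i j (A0, A1, t, q). f k A0 A1 t q $ i $ j) in
        (\<forall>k i j. rational_fun (F k i j)) \<and>
        \<not> {(A0, A1, t, q). q = 1} \<subseteq> (\<Union>k i j. polar_locus (F k i j)) \<and>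
        (\<forall>k i j A0 A1 t N D.
           t \<noteq> 0 \<longrightarrow> t \<noteq> 1 \<longrightarrow> represents N D (F k i j) \<longrightarrow> D (A0, A1, t, 1) \<noteq> 0 \<longrightarrow>
           h k A0 A1 t $ i $ j = N (A0, A1, t, 1) / D (A0, A1, t, 1)))"

datatype residue = Res_0 | Res_1 | Res_t

fun qschlesinger ::
  "complex poly fract \<Rightarrow> complex poly fract \<Rightarrow> residue \<Rightarrow> mat2 \<Rightarrow> mat2 \<Rightarrow> complex \<Rightarrow> complex \<Rightarrow> mat2" where
  "qschlesinger \<Theta>t \<Theta>inf Res_0 A0 A1 t q = qschlesinger_0 \<Theta>t \<Theta>inf A0 A1 t q"
| "qschlesinger \<Theta>t \<Theta>inf Res_1 A0 A1 t q = qschlesinger_1 \<Theta>t \<Theta>inf A0 A1 t q"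
| "qschlesinger \<Theta>t \<Theta>inf Res_t A0 A1 t q = qschlesinger_t \<Theta>t \<Theta>inf A0 A1 t q"

fun schlesinger :: "residue \<Rightarrow> mat2 \<Rightarrow> mat2 \<Rightarrow> mat2 \<Rightarrow> complex \<Rightarrow> mat2" where
  "schlesinger Res_0 A0 A1 At t = schlesinger_0 A0 At t"
| "schlesinger Res_1 A0 A1 At t = schlesinger_1 A1 At t"
| "schlesinger Res_t A0 A1 At t = schlesinger_t A0 A1 At t"

text \<open>
  At \<open>q = 1\<close> the matrix \<open>qA_inf\<close> becomes \<open>diag (\<theta>/2, -\<theta>/2)\<close>, because
  \<open>\<Theta> = 1 + (q - 1) \<theta>/2 + O((q - 1)^2)\<close>.
\<close>

definition A_t :: "complex \<Rightarrow> mat2 \<Rightarrow> mat2 \<Rightarrow> mat2" where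
  "A_t \<theta>inf A0 A1 = - (A0 + A1 + diag2 (\<theta>inf / 2) (- \<theta>inf / 2))"

text \<open>\<open>O(q - 1)\<close> as \<open>q \<rightarrow> 1\<close> for matrix functions, entry by entry.\<close>

definition eq_up_to_O :: "(complex \<Rightarrow> mat2) \<Rightarrow> (complex \<Rightarrow> mat2) \<Rightarrow> bool" where
  "eq_up_to_O F G \<longleftrightarrow> (\<forall>i j. (\<lambda>q. F q $ i $ j - G q $ i $ j) \<in> O[at 1](\<lambda>q. q - 1))"

end

theory Submission
  imports Defs
begin

text \<open>
  Put \<open>\<epsilon> = q - 1\<close> and \<open>B\<^sub>0 = -qt (I + \<epsilon>(Q + R)) (I + \<epsilon>Q)\<^sup>-\<^sup>1 = -qt (I + \<epsilon>W)\<close>, where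
  \<open>W = R (I + \<epsilon>Q)\<^sup>-\<^sup>1\<close>.  Since \<open>(s\<Theta>\<^sub>t - 1)(s/\<Theta>\<^sub>t - 1) = (s - 1)\<^sup>2 + O(\<epsilon>\<^sup>2)\<close>, the matrix \<open>R\<close>
  agrees with \<open>A\<^sub>t\<close> up to \<open>O(\<epsilon>\<^sup>2)\<close>, which is enough for the pole of order two in \<open>f\<^sub>t\<close>.
  Exact identities then write each right-hand side in terms of \<open>W\<close>, \<open>(I + \<epsilon>W)\<^sup>-\<^sup>1\<close> and
  \<open>(I - \<epsilon>uW)\<^sup>-\<^sup>1\<close> with \<open>u = qt/(1 - qt)\<close>, and no power of \<open>1/\<epsilon>\<close> survives.

  The right-hand sides are rational because the matrices to be inverted have invertible limits at
  \<open>q = 1\<close>, so their determinants do not vanish identically.  A power of \<open>q - 1\<close> in the denominator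
  of such a rational function cancels because the function has finite limits as \<open>q \<rightarrow> 1\<close>, which
  shows regularity at the generic point of \<open>q = 1\<close>.
\<close>

section \<open>Matrices\<close>

lemma smult_mat_nth [simp]: "(c *\<^sub>m M) $ i $ j = c * M $ i $ j"
  by (simp add: smult_mat_def)

lemma mat2_mult_nth: "((M :: mat2) ** N) $ i $ j = M $ i $ 1 * N $ 1 $ j + M $ i $ 2 * N $ 2 $ j"
  by (simp add: matrix_matrix_mult_def sum_2)

lemma mat_nth: "mat c $ i $ j = (if i = j then c else 0)"
  by (simp add: mat_def)

lemma mat2_eq_iff:
  "(M :: mat2) = N \<longleftrightarrow>
    M $ 1 $ 1 = N $ 1 $ 1 \<and> M $ 1 $ 2 = N $ 1 $ 2 \<and> M $ 2 $ 1 = N $ 2 $ 1 \<and> M $ 2 $ 2 = N $ 2 $ 2"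
  by (auto simp: vec_eq_iff forall_2)

lemmas mat2_entrywise = mat2_eq_iff mat2_mult_nth mat_nth

lemma diag2_nth:
  "diag2 a b $ 1 $ 1 = a" "diag2 a b $ 1 $ 2 = 0" "diag2 a b $ 2 $ 1 = 0" "diag2 a b $ 2 $ 2 = b"
  by (simp_all add: diag2_def)

lemma diag2_nth_if: "diag2 a b $ i $ j = (if i = j then if i = 1 then a else b else 0)"
  using exhaust_2[of i] exhaust_2[of j] by (auto simp: diag2_nth)

text \<open>\<open>matrix_inv\<close> is a Hilbert choice among two-sided inverses. For square
  matrices a right inverse is two-sided, and two-sided inverses are unique.\<close>

lemma matrix_inv_eqI:
  fixes M N :: mat2
  assumes "M ** N = mat 1"
  shows "matrix_inv M = N"
proof -
  have NM: "N ** M = mat 1"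
    using assms matrix_left_right_inverse by blast
  have "M ** matrix_inv M = mat 1 \<and> matrix_inv M ** M = mat 1"
    unfolding matrix_inv_def using assms NM by (intro someI_ex[of "\<lambda>X. M ** X = mat 1 \<and> X ** M = mat 1"]) auto
  then have "N ** (M ** matrix_inv M) = N"
    by simp
  then show ?thesis
    using NM by (simp add: matrix_mul_assoc)
qed

text \<open>It makes the entries of an inverse explicit rational expressions in the entries of the
  matrix; both the limits and the rationality of inverses rest on this.\<close>

definition adjugate2 :: "mat2 \<Rightarrow> mat2" where
  "adjugate2 M = vector [vector [M $ 2 $ 2, - M $ 1 $ 2], vector [- M $ 2 $ 1, M $ 1 $ 1]]"

lemma adjugate2_nth:
  "adjugate2 M $ 1 $ 1 = M $ 2 $ 2" "adjugate2 M $ 1 $ 2 = - M $ 1 $ 2"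
  "adjugate2 M $ 2 $ 1 = - M $ 2 $ 1" "adjugate2 M $ 2 $ 2 = M $ 1 $ 1"
  by (simp_all add: adjugate2_def)

lemma smult_mat_algebra:
  fixes M N L :: mat2
  shows "c *\<^sub>m (M + N) = c *\<^sub>m M + c *\<^sub>m N"
    and "c *\<^sub>m (M - N) = c *\<^sub>m M - c *\<^sub>m N"
    and "(c *\<^sub>m M) ** N = c *\<^sub>m (M ** N)"
    and "M ** (c *\<^sub>m N) = c *\<^sub>m (M ** N)"
    and "c *\<^sub>m (d *\<^sub>m M) = (c * d) *\<^sub>m M"
    and "(M + N) ** L = M ** L + N ** L"
    and "(M - N) ** L = M ** L - N ** L"
    and "L ** (M + N) = L ** M + L ** N"
    and "L ** (M - N) = L ** M - L ** N"
    and "M ** (N ** L) = M ** N ** L"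
  by (simp_all add: mat2_entrywise algebra_simps)

lemma smult_mat_uminus: "c *\<^sub>m (- M) = - (c *\<^sub>m M)"
  by (simp add: mat2_eq_iff)

lemma matrix_inv_eq_adjugate2:
  assumes "det (M :: mat2) \<noteq> 0"
  shows "matrix_inv M = (1 / det M) *\<^sub>m adjugate2 M"
proof (rule matrix_inv_eqI)
  have "M ** adjugate2 M = det M *\<^sub>m mat 1"
    by (simp add: mat2_entrywise adjugate2_nth det_2)
  then show "M ** ((1 / det M) *\<^sub>m adjugate2 M) = mat 1"
    using assms by (simp add: smult_mat_algebra mat2_eq_iff)
qed

lemma matrix_inv_mult:
  assumes "det (M :: mat2) \<noteq> 0"
  shows "M ** matrix_inv M = mat 1" "matrix_inv M ** M = mat 1"
proof -
  obtain N where N: "M ** N = mat 1"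
    using assms invertible_det_nz[of M] unfolding invertible_def by blast
  then show "M ** matrix_inv M = mat 1"
    by (simp add: matrix_inv_eqI)
  then show "matrix_inv M ** M = mat 1"
    using matrix_left_right_inverse by blast
qed

lemma matrix_inv_smult:
  assumes "det (M :: mat2) \<noteq> 0" and "c \<noteq> 0"
  shows "matrix_inv (c *\<^sub>m M) = (1 / c) *\<^sub>m matrix_inv M"
  using assms by (intro matrix_inv_eqI) (simp add: smult_mat_algebra matrix_inv_mult mat2_eq_iff)

section \<open>Limits up to an error of order \<open>q - 1\<close>\<close>

text \<open>Convergence together with its rate. The notion is stable under the field operations, so
  limit and error estimate are computed in one pass.\<close>

definition near :: "(complex \<Rightarrow> complex) \<Rightarrow> complex \<Rightarrow> bool" where
  "near f c \<longleftrightarrow> (\<lambda>q. f q - c) \<in> O[at 1](\<lambda>q. q - 1)"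

lemma near_tendsto:
  assumes "near f c"
  shows "(f \<longlongrightarrow> c) (at 1)"
proof -
  have "((\<lambda>q::complex. q - 1) \<longlongrightarrow> 1 - 1) (at 1)"
    by (intro tendsto_intros)
  then have "(\<lambda>q::complex. q - 1) \<in> o[at 1](\<lambda>_. 1)"
    by (intro smalloI_tendsto) auto
  with assms have "(\<lambda>q. f q - c) \<in> o[at 1](\<lambda>_. 1)"
    unfolding near_def by (rule landau_o.big_small_trans)
  then have "((\<lambda>q. f q - c) \<longlongrightarrow> 0) (at 1)"
    by (auto dest: smalloD_tendsto)
  then show ?thesis
    by (simp add: LIM_zero_iff)
qed

lemma near_bounded:
  assumes "near f c"
  shows "f \<in> O[at 1](\<lambda>_. 1)"
  using near_tendsto[OF assms] by (intro bigoI_tendsto[where c = c]) auto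

lemma near_cong:
  assumes "near f c" and "eventually (\<lambda>q. g q = f q) (at 1)"
  shows "near g c"
proof -
  have "eventually (\<lambda>q. g q - c = f q - c) (at 1)"
    using assms(2) by (rule eventually_mono) simp
  from landau_o.big.in_cong[OF this] show ?thesis
    using assms(1) unfolding near_def by blast
qed

text \<open>The closure rules produce the limit as an unsimplified expression. This rule lets them
  synthesise it first and leaves its comparison with the desired value as a last goal.\<close>

lemma near_rhs: "near f c \<Longrightarrow> c = d \<Longrightarrow> near f d"
  by simp

named_theorems near_intros

lemma near_const [near_intros]: "near (\<lambda>_. c) c"
  by (simp add: near_def)

lemma near_ident [near_intros]: "near (\<lambda>q. q) 1"
  by (simp add: near_def)

lemma near_add [near_intros]:
  assumes "near f c" "near g d"
  shows "near (\<lambda>q. f q + g q) (c + d)"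
  using sum_in_bigo(1)[OF assms[unfolded near_def]] by (simp add: near_def algebra_simps)

lemma near_mult [near_intros]:
  assumes "near f c" "near g d"
  shows "near (\<lambda>q. f q * g q) (c * d)"
proof -
  have "(\<lambda>q. (f q - c) * g q) \<in> O[at 1](\<lambda>q. (q - 1) * 1)"
    using assms(1) near_bounded[OF assms(2)] unfolding near_def by (rule landau_o.big.mult)
  moreover have "(\<lambda>q. c * (g q - d)) \<in> O[at 1](\<lambda>q. q - 1)"
    using assms(2) unfolding near_def by (cases "c = 0") auto
  ultimately have "(\<lambda>q. (f q - c) * g q + c * (g q - d)) \<in> O[at 1](\<lambda>q. q - 1)"
    by (intro sum_in_bigo) auto
  then show ?thesis
    by (simp add: near_def algebra_simps)
qed

lemma near_uminus [near_intros]: "near f c \<Longrightarrow> near (\<lambda>q. - f q) (- c)"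
  using near_mult[OF near_const[of "-1"], of f c] by simp

lemma near_diff [near_intros]: "near f c \<Longrightarrow> near g d \<Longrightarrow> near (\<lambda>q. f q - g q) (c - d)"
  using near_add[OF _ near_uminus, of f c g d] by simp

lemma near_eventually_neq:
  assumes "near f c" "c \<noteq> d"
  shows "eventually (\<lambda>q. f q \<noteq> d) (at 1)"
  using tendsto_imp_eventually_ne[OF near_tendsto[OF assms(1)] assms(2)] .

text \<open>The identity \<open>1/f - 1/c = -(f - c)/(c f)\<close> keeps the rate, because
  \<open>1/f\<close> stays bounded when the limit of \<open>f\<close> is not zero.\<close>

lemma near_inverse [near_intros]:
  assumes "near f c" "c \<noteq> 0"
  shows "near (\<lambda>q. inverse (f q)) (inverse c)"
proof -
  have "((\<lambda>q. - inverse c * inverse (f q)) \<longlongrightarrow> - inverse c * inverse c) (at 1)"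
    by (intro tendsto_intros near_tendsto assms)
  then have "(\<lambda>q. - inverse c * inverse (f q)) \<in> O[at 1](\<lambda>_. 1)"
    by (intro bigoI_tendsto[where c = "- inverse c * inverse c"]) auto
  with assms(1) have "(\<lambda>q. (f q - c) * (- inverse c * inverse (f q))) \<in> O[at 1](\<lambda>q. (q - 1) * 1)"
    unfolding near_def by (rule landau_o.big.mult)
  moreover have "eventually (\<lambda>q. inverse (f q) - inverse c = (f q - c) * (- inverse c * inverse (f q))) (at 1)"
    using near_eventually_neq[OF assms]
    by (rule eventually_mono) (use assms(2) in \<open>simp add: field_simps\<close>)
  ultimately show ?thesis
    unfolding near_def by (simp only: landau_o.big.in_cong mult_1_right)
qed

lemma near_divide [near_intros]:
  "near f c \<Longrightarrow> near g d \<Longrightarrow> d \<noteq> 0 \<Longrightarrow> near (\<lambda>q. f q / g q) (c / d)"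
  unfolding divide_inverse by (intro near_intros)

lemma near_power [near_intros]: "near f c \<Longrightarrow> near (\<lambda>q. f q ^ n) (c ^ n)"
  by (induction n) (auto intro!: near_intros)

section \<open>Entrywise estimates for matrix functions\<close>

abbreviation mnear :: "(complex \<Rightarrow> mat2) \<Rightarrow> mat2 \<Rightarrow> bool" where
  "mnear F L \<equiv> eq_up_to_O F (\<lambda>_. L)"

lemma mnear_iff: "mnear F L \<longleftrightarrow> (\<forall>i j. near (\<lambda>q. F q $ i $ j) (L $ i $ j))"
  by (simp add: eq_up_to_O_def near_def)

lemma mnear_cong:
  assumes "mnear F L" and "eventually (\<lambda>q. G q = F q) (at 1)"
  shows "mnear G L"
  unfolding mnear_iff
proof (intro allI)
  fix i j
  show "near (\<lambda>q. G q $ i $ j) (L $ i $ j)"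
    by (rule near_cong[of "\<lambda>q. F q $ i $ j"])
       (use assms in \<open>auto simp: mnear_iff elim: eventually_mono\<close>)
qed

lemma mnear_rhs: "mnear F L \<Longrightarrow> L = L' \<Longrightarrow> mnear F L'"
  by simp

lemma mnear_const [near_intros]: "mnear (\<lambda>_. L) L"
  by (simp add: mnear_iff near_const)

lemma mnear_add [near_intros]: "mnear F L \<Longrightarrow> mnear G M \<Longrightarrow> mnear (\<lambda>q. F q + G q) (L + M)"
  by (simp add: mnear_iff near_add)

lemma mnear_diff [near_intros]: "mnear F L \<Longrightarrow> mnear G M \<Longrightarrow> mnear (\<lambda>q. F q - G q) (L - M)"
  by (simp add: mnear_iff near_diff)

lemma mnear_uminus [near_intros]: "mnear F L \<Longrightarrow> mnear (\<lambda>q. - F q) (- L)"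
  by (simp add: mnear_iff near_uminus)

lemma mnear_smult [near_intros]: "near f c \<Longrightarrow> mnear F L \<Longrightarrow> mnear (\<lambda>q. f q *\<^sub>m F q) (c *\<^sub>m L)"
  by (simp add: mnear_iff near_mult)

lemma mnear_mult [near_intros]: "mnear F L \<Longrightarrow> mnear G M \<Longrightarrow> mnear (\<lambda>q. F q ** G q) (L ** M)"
  by (simp add: mnear_iff mat2_mult_nth near_mult near_add)

lemma mnear_diag2: "near f c \<Longrightarrow> near g d \<Longrightarrow> mnear (\<lambda>q. diag2 (f q) (g q)) (diag2 c d)"
  by (simp add: mnear_iff diag2_nth_if near_const)

lemma near_det: "mnear F L \<Longrightarrow> near (\<lambda>q. det (F q)) (det L)"
  unfolding det_2 mnear_iff by (intro near_intros) auto

lemma mnear_eventually_det: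
  "mnear F L \<Longrightarrow> det L \<noteq> 0 \<Longrightarrow> eventually (\<lambda>q. det (F q) \<noteq> 0) (at 1)"
  by (rule near_eventually_neq[OF near_det])

lemma mnear_adjugate2: "mnear F L \<Longrightarrow> mnear (\<lambda>q. adjugate2 (F q)) (adjugate2 L)"
  by (simp add: mnear_iff forall_2 adjugate2_nth near_uminus)

lemma mnear_matrix_inv:
  assumes "mnear F L" "det L \<noteq> 0"
  shows "mnear (\<lambda>q. matrix_inv (F q)) (matrix_inv L)"
proof -
  have "mnear (\<lambda>q. (1 / det (F q)) *\<^sub>m adjugate2 (F q)) ((1 / det L) *\<^sub>m adjugate2 L)"
    by (intro near_intros near_det mnear_adjugate2 assms)
  then show ?thesis
    using mnear_eventually_det[OF assms]
    by (subst matrix_inv_eq_adjugate2[OF assms(2)], elim mnear_cong)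
       (auto elim: eventually_mono simp: matrix_inv_eq_adjugate2)
qed

text \<open>Estimates are proved against constant limits; this passes to comparison functions that
  still depend on \<open>q\<close>.\<close>

lemma mnear_imp_eq_up_to_O:
  assumes "mnear F L" "mnear G L"
  shows "eq_up_to_O F G"
  unfolding eq_up_to_O_def
proof (intro allI)
  fix i j
  from assms have "near (\<lambda>q. F q $ i $ j - G q $ i $ j) (L $ i $ j - L $ i $ j)"
    by (intro near_diff) (auto simp: mnear_iff)
  then show "(\<lambda>q. F q $ i $ j - G q $ i $ j) \<in> O[at 1](\<lambda>q. q - 1)"
    by (simp add: near_def)
qed

section \<open>Rational functions of \<open>q\<close>\<close>

lemma eventually_poly_neq_0:
  fixes p :: "complex poly"
  assumes "p \<noteq> 0"
  shows "eventually (\<lambda>q. poly p q \<noteq> 0) (at a)"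
proof -
  \<comment> \<open>The point \<open>a\<close> may itself be a root; it is taken out of the finite
    root set because \<open>at a\<close> ignores it.\<close>
  have "open (- ({q. poly p q = 0} - {a}))"
    using assms by (intro open_Compl finite_imp_closed finite_Diff poly_roots_finite)
  then show ?thesis
    unfolding eventually_at_topological by (intro exI[of _ "- ({q. poly p q = 0} - {a})"]) auto
qed

text \<open>The reduced fractions of \<open>r\<close> and \<open>inverse r\<close> are compared by
  cross-multiplication only. This fixes the values away from the roots of three nonzero polynomials,
  which suffices near \<open>a\<close>.\<close>

lemma eventually_rat_eval_inverse:
  assumes "r \<noteq> 0"
  shows "eventually (\<lambda>q. rat_eval (inverse r) q = inverse (rat_eval r q)) (at a)"
proof -
  let ?n = "\<lambda>r. fst (quot_of_fract r)" and ?d = "\<lambda>r. snd (quot_of_fract r)"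
  have "Fract (?n r * ?n (inverse r)) (?d r * ?d (inverse r)) = r * inverse r"
    unfolding mult_fract[symmetric] Fract_quot_of_fract ..
  also have "\<dots> = Fract 1 1"
    using assms by (simp add: One_fract_def)
  finally have "?n r * ?n (inverse r) = ?d r * ?d (inverse r)"
    by (simp add: eq_fract)
  then have eq: "poly (?n r) q * poly (?n (inverse r)) q = poly (?d r) q * poly (?d (inverse r)) q" for q
    by (metis poly_mult)
  have "?n r \<noteq> 0" "?d r \<noteq> 0" "?d (inverse r) \<noteq> 0"
    using assms by auto
  then have "eventually (\<lambda>q. poly (?n r) q \<noteq> 0 \<and> poly (?d r) q \<noteq> 0 \<and> poly (?d (inverse r)) q \<noteq> 0) (at a)"
    by (auto intro!: eventually_conj eventually_poly_neq_0)
  then show ?thesis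
    by (rule eventually_mono) (use eq in \<open>auto simp: rat_eval_def field_simps\<close>)
qed

lemma near_difference_quotient:
  assumes "(\<lambda>q. f q - (1 + (q - 1) * c)) \<in> O[at 1](\<lambda>q. (q - 1)^2)"
  shows "near (\<lambda>q. (f q - 1) / (q - 1)) c" "near f 1"
proof -
  have "(\<lambda>q. (f q - (1 + (q - 1) * c)) / (q - 1)) \<in> O[at 1](\<lambda>q. (q - 1)^2 / (q - 1))"
    using assms by (intro landau_o.big.divide_right) (auto simp: eventually_at_filter)
  \<comment> \<open>An equality of functions even at \<open>q = 1\<close>, where division by zero
    gives 0 on the left.\<close>
  also have "(\<lambda>q. (q - 1)^2 / (q - 1)) = (\<lambda>q::complex. q - 1)"
    by (auto simp: power2_eq_square)
  finally have "(\<lambda>q. (f q - (1 + (q - 1) * c)) / (q - 1)) \<in> O[at 1](\<lambda>q. q - 1)" .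
  moreover have "eventually (\<lambda>q. (f q - (1 + (q - 1) * c)) / (q - 1) = (f q - 1) / (q - 1) - c) (at 1)"
    by (auto simp: eventually_at_filter field_simps)
  ultimately show *: "near (\<lambda>q. (f q - 1) / (q - 1)) c"
    unfolding near_def by (simp only: landau_o.big.in_cong)
  have "near (\<lambda>q. 1 + (q - 1) * ((f q - 1) / (q - 1))) 1"
    by (rule near_rhs, (rule near_intros *)+) simp
  then show "near f 1"
    by (rule near_cong) (auto simp: eventually_at_filter)
qed

section \<open>The q-Schlesinger right-hand sides near \<open>q = 1\<close>\<close>

text \<open>Since \<open>mat 1\<close> commutes with \<open>A\<close>, the commutator of
  \<open>mat 1 + e W\<close> with \<open>A\<close> is \<open>e\<close> times that of
  \<open>W\<close> with \<open>A\<close>. The conjugate thus differs from \<open>A\<close> by an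
  explicit multiple of \<open>e\<close>, which cancels a simple pole.\<close>

lemma conjugation_minus_self:
  fixes A W V :: mat2
  assumes "(mat 1 + e *\<^sub>m W) ** V = mat 1"
  shows "(mat 1 + e *\<^sub>m W) ** A ** V = A + e *\<^sub>m ((W ** A - A ** W) ** V)"
proof -
  have "e *\<^sub>m ((W ** A - A ** W) ** V) = ((mat 1 + e *\<^sub>m W) ** A - A ** (mat 1 + e *\<^sub>m W)) ** V"
    by (simp add: smult_mat_algebra)
  also have "\<dots> = (mat 1 + e *\<^sub>m W) ** A ** V - A ** ((mat 1 + e *\<^sub>m W) ** V)"
    unfolding smult_mat_algebra(7) matrix_mul_assoc ..
  finally show ?thesis
    using assms by simp
qed

section \<open>Exact identities at a fixed value of \<open>q\<close>, with \<open>e\<close> standing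
  for \<open>q - 1\<close>\<close>

context
  fixes e q t u v :: complex and W B :: mat2
  assumes e: "e \<noteq> 0" and q: "q \<noteq> 0" and t: "t \<noteq> 0" "t \<noteq> 1" and qt: "q * t \<noteq> 1"
    and u: "u = q * t / (1 - q * t)" and v: "v = t / (1 - t)"
    and det_V: "det (mat 1 + e *\<^sub>m W) \<noteq> 0"
    and det_Z: "det (mat 1 - (e * u) *\<^sub>m W) \<noteq> 0"
    and B: "B = (- (q * t)) *\<^sub>m (mat 1 + e *\<^sub>m W)"
begin

lemma matrix_inv_B: "matrix_inv B = (- 1 / (q * t)) *\<^sub>m matrix_inv (mat 1 + e *\<^sub>m W)"
  using matrix_inv_smult[OF det_V, of "- (q * t)"] q t unfolding B by simp

text \<open>The constants \<open>u\<close> here and \<open>v\<close> in the next lemma are chosen so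
  that \<open>mat 1 + B\<close> and \<open>mat q + B\<close> become scalars times perturbations of
  the identity of order \<open>e\<close>.\<close>

lemma mat_1_plus_B: "mat 1 + B = (1 - q * t) *\<^sub>m (mat 1 - (e * u) *\<^sub>m W)"
  using qt by (simp add: B u mat2_entrywise field_simps)

lemma mat_q_plus_B: "mat q + B = (q * (1 - t)) *\<^sub>m (mat 1 - (e * v) *\<^sub>m W)"
proof -
  have "(1 - t) * v = t"
    using t v by simp
  then show ?thesis
    by (simp add: B mat2_entrywise algebra_simps) algebra
qed

lemma matrix_inv_mat_1_plus_B:
  "matrix_inv (mat 1 + B) = (1 / (1 - q * t)) *\<^sub>m matrix_inv (mat 1 - (e * u) *\<^sub>m W)"
  using matrix_inv_smult[OF det_Z, of "1 - q * t"] qt unfolding mat_1_plus_B by simp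

lemma conjugation_by_B:
  "B ** A0 ** matrix_inv B = A0 + e *\<^sub>m ((W ** A0 - A0 ** W) ** matrix_inv (mat 1 + e *\<^sub>m W))"
  (is "_ = ?rhs")
proof -
  have "B ** A0 ** matrix_inv B = (mat 1 + e *\<^sub>m W) ** A0 ** matrix_inv (mat 1 + e *\<^sub>m W)"
    unfolding matrix_inv_B unfolding B using q t
    by (simp only: smult_mat_algebra(3,4,5)) (simp add: mat2_eq_iff)
  then show ?thesis
    using conjugation_minus_self[OF matrix_inv_mult(1)[OF det_V]] by simp
qed

lemma qschlesinger_0_exact:
  "(1 / (e * t)) *\<^sub>m (B ** A0 ** matrix_inv B - A0)
    = (1 / t) *\<^sub>m ((W ** A0 - A0 ** W) ** matrix_inv (mat 1 + e *\<^sub>m W))"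
  unfolding conjugation_by_B using e t by (simp add: mat2_eq_iff)

text \<open>Here \<open>m\<close> collects the prefactor \<open>k\<close> and the scalars pulled out
  of \<open>mat q + B\<close> and of the inverse of \<open>mat 1 + B\<close>. With \<open>X\<close>
  the remaining matrix product, the bracket is \<open>(m - 1) X + (X - A1)\<close>; the second
  summand is an explicit multiple of \<open>e\<close>, so only the scalar \<open>(m - 1) / e\<close>
  has to be estimated later.\<close>

lemma qschlesinger_1_exact:
  fixes k :: complex and A1 :: mat2
  defines "m \<equiv> k * (q * (1 - t) / (1 - q * t))"
  shows "(1 / (e * t)) *\<^sub>m (k *\<^sub>m ((mat q + B) ** A1 ** matrix_inv (mat 1 + B)) - A1)
    = (1 / t) *\<^sub>m (((m - 1) / e) *\<^sub>m ((mat 1 - (e * v) *\<^sub>m W) ** A1 ** matrix_inv (mat 1 - (e * u) *\<^sub>m W))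
       + (u *\<^sub>m (A1 ** W) - v *\<^sub>m (W ** A1)) ** matrix_inv (mat 1 - (e * u) *\<^sub>m W))"
proof -
  define Z where "Z = matrix_inv (mat 1 - (e * u) *\<^sub>m W)"
  define X where "X = (mat 1 - (e * v) *\<^sub>m W) ** A1 ** Z"
  have "e *\<^sub>m ((u *\<^sub>m (A1 ** W) - v *\<^sub>m (W ** A1)) ** Z)
      = ((mat 1 - (e * v) *\<^sub>m W) ** A1 - A1 ** (mat 1 - (e * u) *\<^sub>m W)) ** Z"
    by (simp add: smult_mat_algebra)
  also have "\<dots> = X - A1 ** ((mat 1 - (e * u) *\<^sub>m W) ** Z)"
    by (simp add: X_def smult_mat_algebra)
  also have "\<dots> = X - A1"
    using matrix_inv_mult(1)[OF det_Z] by (simp add: Z_def)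
  finally have A1: "A1 = X - e *\<^sub>m ((u *\<^sub>m (A1 ** W) - v *\<^sub>m (W ** A1)) ** Z)"
    by simp
  have "k *\<^sub>m ((mat q + B) ** A1 ** matrix_inv (mat 1 + B)) = m *\<^sub>m X"
    unfolding matrix_inv_mat_1_plus_B mat_q_plus_B X_def Z_def m_def
    by (simp only: smult_mat_algebra(3,4,5)) (simp add: mat2_eq_iff)
  then have "k *\<^sub>m ((mat q + B) ** A1 ** matrix_inv (mat 1 + B)) - A1
      = (m - 1) *\<^sub>m X + e *\<^sub>m ((u *\<^sub>m (A1 ** W) - v *\<^sub>m (W ** A1)) ** Z)"
    by (subst (2) A1) (simp add: mat2_eq_iff algebra_simps)
  then show ?thesis
    using e t unfolding X_def Z_def by (simp add: mat2_eq_iff field_simps)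
qed

text \<open>The double pole meets \<open>mat 1 + B/(qt) = -e W\<close> and becomes simple; the
  remaining \<open>W/e\<close> is paired with \<open>At\<close>. The other two products each yield a
  factor \<open>e\<close>, so \<open>(W - At)/e\<close> and one scalar quotient are all that is left
  to estimate.\<close>

lemma qschlesinger_t_exact:
  fixes k l :: complex and A0 A1 At :: mat2
  shows "- ((1 / (e^2 * t)) *\<^sub>m (mat 1 + (1 / (q * t)) *\<^sub>m B))
      - (1 / (e * t)) *\<^sub>m (B ** A0 ** (mat (1 / (q * t)) + matrix_inv B) + At)
      - ((t - 1) / (q * e * t * k)) *\<^sub>m
          ((mat q + B) ** A1 ** (mat 1 + (l / (q * t - 1)) *\<^sub>m matrix_inv (mat 1 + B)))
    = (1 / t) *\<^sub>m ((1 / e) *\<^sub>m (W - At) + W ** A0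
         - (W ** A0 - A0 ** W) ** matrix_inv (mat 1 + e *\<^sub>m W)
       + ((t - 1)^2 / k) *\<^sub>m ((mat 1 - (e * v) *\<^sub>m W) ** A1
          ** (((1 - l / (q * t - 1)^2) / e) *\<^sub>m mat 1 - u *\<^sub>m W)
          ** matrix_inv (mat 1 - (e * u) *\<^sub>m W)))"
proof -
  define Z where "Z = matrix_inv (mat 1 - (e * u) *\<^sub>m W)"
  define C where "C = (W ** A0 - A0 ** W) ** matrix_inv (mat 1 + e *\<^sub>m W)"
  define r where "r = l / (q * t - 1)^2"
  define X where "X = (mat 1 - (e * v) *\<^sub>m W) ** A1 ** (((1 - r) / e) *\<^sub>m mat 1 - u *\<^sub>m W) ** Z"
  have cB: "(1 / (q * t)) *\<^sub>m B = - (mat 1 + e *\<^sub>m W)"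
    using q t by (simp add: B mat2_eq_iff field_simps)
  have "B ** A0 ** mat (1 / (q * t)) = ((1 / (q * t)) *\<^sub>m B) ** A0"
    by (simp add: mat2_entrywise algebra_simps)
  also have "\<dots> = - A0 - e *\<^sub>m (W ** A0)"
    unfolding cB by (simp add: mat2_entrywise algebra_simps)
  finally have BA0: "B ** A0 ** (mat (1 / (q * t)) + matrix_inv B) = e *\<^sub>m (C - W ** A0)"
    unfolding smult_mat_algebra(8) conjugation_by_B C_def
    by (simp add: mat2_eq_iff algebra_simps)
  have one_plus_cB: "mat 1 + (1 / (q * t)) *\<^sub>m B = - (e *\<^sub>m W)"
    unfolding cB by simp
  have BA1: "(mat q + B) ** A1 ** (mat 1 + (l / (q * t - 1)) *\<^sub>m matrix_inv (mat 1 + B))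
      = (e * (q * (1 - t))) *\<^sub>m X"
  proof -
    have "(l / (q * t - 1)) *\<^sub>m matrix_inv (mat 1 + B) = (- r) *\<^sub>m Z"
    proof -
      have "l / x * (1 / y) = - (l / x^2)" if "y = - x" for x y
        by (simp add: that power2_eq_square)
      from this[where x = "q * t - 1" and y = "1 - q * t"]
      have "l / (q * t - 1) * (1 / (1 - q * t)) = - r"
        unfolding r_def by simp
      then show ?thesis
        unfolding matrix_inv_mat_1_plus_B Z_def smult_mat_algebra(5) by simp
    qed
    \<comment> \<open>Writing \<open>mat 1\<close> as \<open>(mat 1 - (e u) W) ** Z\<close> makes
      \<open>Z\<close> a common right factor, after which \<open>e\<close> can be extracted.\<close>
    then have "mat 1 + (l / (q * t - 1)) *\<^sub>m matrix_inv (mat 1 + B)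
        = (mat 1 - (e * u) *\<^sub>m W) ** Z + (- r) *\<^sub>m Z"
      using matrix_inv_mult(1)[OF det_Z] by (simp add: Z_def)
    also have "\<dots> = e *\<^sub>m ((((1 - r) / e) *\<^sub>m mat 1 - u *\<^sub>m W) ** Z)"
      using e by (simp add: smult_mat_algebra mat2_eq_iff) (simp add: field_simps)
    finally show ?thesis
      unfolding mat_q_plus_B X_def
      by (simp only: smult_mat_algebra(3,4,5) matrix_mul_assoc)
  qed
  \<comment> \<open>For \<open>k = 0\<close> both quotients by \<open>k\<close> are 0 by convention,
    so the identity holds there too; the case split lets \<open>field_simps\<close> clear
    \<open>k\<close> otherwise.\<close>
  show ?thesis
    unfolding BA0 one_plus_cB BA1 r_def[symmetric] Z_def[symmetric] X_def[symmetric] C_def[symmetric]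
    using e q t by (cases "k = 0") (simp_all add: mat2_eq_iff power2_eq_square field_simps)
qed

end

section \<open>Asymptotics of the coefficients at \<open>q = 1\<close>\<close>

locale theta_asymptotics =
  fixes \<theta>t \<theta>inf :: complex and \<Theta>t \<Theta>inf :: "complex poly fract"
  assumes \<Theta>t: "(\<lambda>q. rat_eval \<Theta>t q - (1 + (q - 1) * (\<theta>t / 2))) \<in> O[at 1](\<lambda>q. (q - 1)^2)"
    and \<Theta>inf: "(\<lambda>q. rat_eval \<Theta>inf q - (1 + (q - 1) * (\<theta>inf / 2))) \<in> O[at 1](\<lambda>q. (q - 1)^2)"
begin

lemma nonzero_if_near_1: "near (rat_eval r) 1 \<Longrightarrow> r \<noteq> 0"
proof
  assume "near (rat_eval r) 1" "r = 0"
  then have "eventually (\<lambda>_. False) (at (1::complex))"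
    using near_eventually_neq[of "rat_eval r" 1 0] by (simp add: rat_eval_def)
  then show False
    by simp
qed

lemmas near_\<Theta>t = near_difference_quotient[OF \<Theta>t]
lemmas near_\<Theta>inf = near_difference_quotient[OF \<Theta>inf]

lemmas eventually_inverse_\<Theta>t =
  eventually_rat_eval_inverse[OF nonzero_if_near_1[OF near_\<Theta>t(2)], of 1]
lemmas eventually_inverse_\<Theta>inf =
  eventually_rat_eval_inverse[OF nonzero_if_near_1[OF near_\<Theta>inf(2)], of 1]

lemma eventually_\<Theta>t_neq_0: "eventually (\<lambda>q. rat_eval \<Theta>t q \<noteq> 0) (at 1)"
  by (rule near_eventually_neq[OF near_\<Theta>t(2)]) simp

text \<open>For the upper entry, \<open>(1 - 1/x)/(q - 1) = ((x - 1)/(q - 1))/x\<close> with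
  \<open>x\<close> the value of \<open>\<Theta>inf\<close>, and \<open>x\<close> tends to 1.\<close>

lemma near_qA_inf: "mnear (qA_inf \<Theta>inf) (diag2 (\<theta>inf / 2) (- \<theta>inf / 2))"
proof -
  have "near (\<lambda>q. (rat_eval \<Theta>inf q - 1) / (q - 1) / rat_eval \<Theta>inf q) (\<theta>inf / 2)"
    by (rule near_rhs, (rule near_\<Theta>inf near_intros)+) simp_all
  moreover have "eventually (\<lambda>q. (1 - rat_eval (inverse \<Theta>inf) q) / (q - 1)
      = (rat_eval \<Theta>inf q - 1) / (q - 1) / rat_eval \<Theta>inf q) (at 1)"
    using eventually_inverse_\<Theta>inf near_eventually_neq[OF near_\<Theta>inf(2) one_neq_zero]
  proof eventually_elim
    case (elim q)
    then have "1 - inverse (rat_eval \<Theta>inf q) = (rat_eval \<Theta>inf q - 1) / rat_eval \<Theta>inf q"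
      by (simp add: field_simps)
    then show ?case
      unfolding elim(1) by (simp add: mult.commute)
  qed
  ultimately have 1: "near (\<lambda>q. (1 - rat_eval (inverse \<Theta>inf) q) / (q - 1)) (\<theta>inf / 2)"
    by (rule near_cong)
  have "near (\<lambda>q. - ((rat_eval \<Theta>inf q - 1) / (q - 1))) (- \<theta>inf / 2)"
    by (rule near_rhs, (rule near_\<Theta>inf near_intros)+) simp
  then have 2: "near (\<lambda>q. (1 - rat_eval \<Theta>inf q) / (q - 1)) (- \<theta>inf / 2)"
    by (simp only: minus_divide_left minus_diff_eq)
  show ?thesis
    unfolding qA_inf_def[abs_def] by (rule mnear_diag2[OF 1 2])
qed

lemma near_qA_t: "mnear (qA_t \<Theta>inf A0 A1) (A_t \<theta>inf A0 A1)"
  unfolding qA_t_def[abs_def] A_t_def by (intro near_intros near_qA_inf)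

text \<open>Since \<open>(s \<Theta> - 1) (s / \<Theta> - 1) = (s - 1)\<^sup>2 - s (\<Theta> - 1)\<^sup>2 / \<Theta>\<close>, the
  first-order terms cancel.\<close>

lemma near_qquad:
  assumes "near s s0"
  shows "near (\<lambda>q. (qquad \<Theta>t (s q) q - (s q - 1)^2) / (q - 1)) 0"
    and "near (\<lambda>q. qquad \<Theta>t (s q) q) ((s0 - 1)^2)"
proof -
  have "near (\<lambda>q. - (s q * ((rat_eval \<Theta>t q - 1) * ((rat_eval \<Theta>t q - 1) / (q - 1)) / rat_eval \<Theta>t q))) 0"
    by (rule near_rhs, (rule near_\<Theta>t assms near_intros)+) simp_all
  moreover have "eventually (\<lambda>q. (qquad \<Theta>t (s q) q - (s q - 1)^2) / (q - 1)
      = - (s q * ((rat_eval \<Theta>t q - 1) * ((rat_eval \<Theta>t q - 1) / (q - 1)) / rat_eval \<Theta>t q))) (at 1)"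
    using eventually_inverse_\<Theta>t eventually_\<Theta>t_neq_0 eventually_neq_at_within[of 1]
  proof eventually_elim
    case (elim q)
    have "qquad \<Theta>t (s q) q - (s q - 1)^2
      = - (s q * ((rat_eval \<Theta>t q - 1) * (rat_eval \<Theta>t q - 1) / rat_eval \<Theta>t q))"
      using elim(1,2) by (simp add: qquad_def field_simps power2_eq_square)
    then show ?case
      by simp
  qed
  ultimately show *: "near (\<lambda>q. (qquad \<Theta>t (s q) q - (s q - 1)^2) / (q - 1)) 0"
    by (rule near_cong)
  have "near (\<lambda>q. (s q - 1)^2 + (q - 1) * ((qquad \<Theta>t (s q) q - (s q - 1)^2) / (q - 1))) ((s0 - 1)^2)"
    by (rule near_rhs, (rule assms * near_intros)+) simp
  then show "near (\<lambda>q. qquad \<Theta>t (s q) q) ((s0 - 1)^2)"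
    by (rule near_cong) (auto simp: eventually_at_filter)
qed

section \<open>Expansion of the right-hand sides for fixed \<open>A0\<close>, \<open>A1\<close>,
  \<open>t\<close>\<close>

context
  fixes A0 A1 :: mat2 and t :: complex
  assumes t: "t \<noteq> 0" "t \<noteq> 1"
begin

definition "Q q = A0 + (t * (t - 1) / qquad \<Theta>t t q) *\<^sub>m A1"

text \<open>The difference of the first-order coefficients of the two factors of \<open>B0\<close>,
  rearranged to display its deviation from \<open>qA_t\<close> as a scalar multiple of
  \<open>A1\<close>.\<close>

definition "R q = qA_t \<Theta>inf A0 A1 q + (1 - (t - 1)^2 / qquad \<Theta>t t q) *\<^sub>m A1"

definition "W q = R q ** matrix_inv (mat 1 + (q - 1) *\<^sub>m Q q)"

lemma near_qquad_t:
  "near (\<lambda>q. (qquad \<Theta>t t q - (t - 1)^2) / (q - 1)) 0" "near (qquad \<Theta>t t) ((t - 1)^2)"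
  using near_qquad[OF near_const[of t]] .

lemma near_qquad_qt:
  "near (\<lambda>q. (qquad \<Theta>t (q * t) q - (q * t - 1)^2) / (q - 1)) 0"
  "near (\<lambda>q. qquad \<Theta>t (q * t) q) ((t - 1)^2)"
  using near_qquad[of "\<lambda>q. q * t" t] near_mult[OF near_ident near_const[of t]] by simp_all

lemma eventually_generic:
  "eventually (\<lambda>q. q \<noteq> 1 \<and> q \<noteq> 0 \<and> q * t \<noteq> 1 \<and> qquad \<Theta>t t q \<noteq> 0 \<and>
     rat_eval \<Theta>t q * rat_eval (inverse \<Theta>t) q = 1) (at 1)"
proof -
  have "eventually (\<lambda>q. q * t \<noteq> 1) (at 1)"
    by (rule near_eventually_neq[of _ "1 * t"], (rule near_intros)+) (use t in simp)
  moreover have "eventually (\<lambda>q. qquad \<Theta>t t q \<noteq> 0) (at 1)"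
    by (rule near_eventually_neq[OF near_qquad_t(2)]) (use t in simp)
  moreover have "eventually (\<lambda>q::complex. q \<noteq> 0) (at 1)"
    by (rule near_eventually_neq[OF near_ident]) simp
  ultimately show ?thesis
    using eventually_neq_at_within[of 1] eventually_inverse_\<Theta>t eventually_\<Theta>t_neq_0
    by eventually_elim simp
qed

lemma near_Q: "mnear Q (A0 + (t / (t - 1)) *\<^sub>m A1)"
  unfolding Q_def[abs_def]
  by (rule mnear_rhs, (rule near_qquad_t near_intros | (insert t, simp; fail))+) (use t in \<open>simp_all add: power2_eq_square\<close>)

text \<open>The scalar in \<open>R - qA_t\<close> is of second order in \<open>q - 1\<close>, so it
  vanishes even after division by \<open>q - 1\<close>; the simple pole left in \<open>f_t\<close>
  requires this.\<close>

lemma near_R_minus_At: "near (\<lambda>q. (1 - (t - 1)^2 / qquad \<Theta>t t q) / (q - 1)) 0"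
proof -
  have "near (\<lambda>q. (qquad \<Theta>t t q - (t - 1)^2) / (q - 1) / qquad \<Theta>t t q) 0"
    by (rule near_rhs, (rule near_qquad_t near_intros | (insert t, simp; fail))+)
  then show ?thesis
    by (rule near_cong) (use eventually_generic in \<open>auto elim!: eventually_mono simp: field_simps\<close>)
qed

lemma near_lambda: "near (\<lambda>q. (1 - qquad \<Theta>t (q * t) q / (q * t - 1)^2) / (q - 1)) 0"
proof -
  have "near (\<lambda>q. - ((qquad \<Theta>t (q * t) q - (q * t - 1)^2) / (q - 1) / (q * t - 1)^2)) 0"
    by (rule near_rhs, (rule near_qquad_qt near_intros | (insert t, simp; fail))+)
  then show ?thesis
    by (rule near_cong) (use eventually_generic in \<open>auto elim!: eventually_mono simp: field_simps\<close>)
qed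

text \<open>The quantity \<open>(m - 1) / e\<close> of \<open>qschlesinger_1_exact\<close>. With
  \<open>m = a b\<close>, where \<open>a = (t - 1)^2 / qquad(t)\<close> and
  \<open>b = qquad(q t) / (q t - 1)^2\<close>, one has
  \<open>a b - 1 = -((1 - a) b + (1 - b))\<close>, and both differences are already
  estimated.\<close>

lemma near_mu:
  "near (\<lambda>q. ((t - 1)^2 * qquad \<Theta>t (q * t) q / ((q * t - 1)^2 * qquad \<Theta>t t q) - 1) / (q - 1)) 0"
proof -
  have "near (\<lambda>q. - ((1 - (t - 1)^2 / qquad \<Theta>t t q) / (q - 1) * (qquad \<Theta>t (q * t) q / (q * t - 1)^2)
       + (1 - qquad \<Theta>t (q * t) q / (q * t - 1)^2) / (q - 1))) 0"
    by (rule near_rhs, (rule near_qquad_qt near_lambda near_R_minus_At near_intros | (insert t, simp; fail))+)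
  moreover have "- ((1 - (t - 1)^2 / z) / e * (x / y) + (1 - x / y) / e) = ((t - 1)^2 * x / (y * z) - 1) / e"
    for x y z e :: complex
    by (simp add: diff_divide_distrib left_diff_distrib right_diff_distrib mult.commute)
  ultimately show ?thesis
    by simp
qed

lemma near_Y: "mnear (\<lambda>q. mat 1 + (q - 1) *\<^sub>m Q q) (mat 1)"
  by (rule mnear_rhs, (rule near_Q near_intros | (insert t, simp; fail))+) (simp add: mat2_eq_iff)

lemma near_inverse_Y: "mnear (\<lambda>q. matrix_inv (mat 1 + (q - 1) *\<^sub>m Q q)) (mat 1)"
  using mnear_matrix_inv[OF near_Y] matrix_inv_eqI[of "mat 1" "mat 1"] by simp

lemma near_R: "mnear R (A_t \<theta>inf A0 A1)"
  unfolding R_def[abs_def]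
  by (rule mnear_rhs, (rule near_qquad_t near_qA_t near_intros | (insert t, simp; fail))+) (use t in \<open>simp_all add: mat2_eq_iff\<close>)

lemma near_W: "mnear W (A_t \<theta>inf A0 A1)"
  unfolding W_def[abs_def] by (rule mnear_rhs, (rule near_R near_inverse_Y near_intros | (insert t, simp; fail))+)

lemma near_V: "mnear (\<lambda>q. mat 1 + (q - 1) *\<^sub>m W q) (mat 1)"
  by (rule mnear_rhs, (rule near_W near_intros | (insert t, simp; fail))+) (simp add: mat2_eq_iff)

lemma near_inverse_V: "mnear (\<lambda>q. matrix_inv (mat 1 + (q - 1) *\<^sub>m W q)) (mat 1)"
  using mnear_matrix_inv[OF near_V] matrix_inv_eqI[of "mat 1" "mat 1"] by simp

lemma near_u: "near (\<lambda>q. q * t / (1 - q * t)) (t / (1 - t))"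
  by (rule near_rhs, (rule near_intros | (insert t, simp; fail))+)

lemma near_Z: "mnear (\<lambda>q. mat 1 - ((q - 1) * (q * t / (1 - q * t))) *\<^sub>m W q) (mat 1)"
  by (rule mnear_rhs, (rule near_W near_u near_intros | (insert t, simp; fail))+) (simp add: mat2_eq_iff)

lemma near_inverse_Z:
  "mnear (\<lambda>q. matrix_inv (mat 1 - ((q - 1) * (q * t / (1 - q * t))) *\<^sub>m W q)) (mat 1)"
  using mnear_matrix_inv[OF near_Z] matrix_inv_eqI[of "mat 1" "mat 1"] by simp

text \<open>The left factor of \<open>B0\<close> equals the matrix to be inverted plus
  \<open>(q - 1) R\<close>, so the quotient is the identity plus \<open>(q - 1) W\<close>.\<close>

lemma B0_eq:
  assumes "det (mat 1 + (q - 1) *\<^sub>m Q q) \<noteq> 0"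
  shows "B0 \<Theta>t \<Theta>inf A0 A1 t q = (- (q * t)) *\<^sub>m (mat 1 + (q - 1) *\<^sub>m W q)"
proof -
  have "((t - 1) / qquad \<Theta>t t q) *\<^sub>m A1 - qA_inf \<Theta>inf q = R q + Q q"
    by (simp add: R_def Q_def qA_t_def mat2_eq_iff add_divide_distrib diff_divide_distrib
        algebra_simps power2_eq_square)
  then have "mat 1 + (q - 1) *\<^sub>m (((t - 1) / qquad \<Theta>t t q) *\<^sub>m A1 - qA_inf \<Theta>inf q)
      = (mat 1 + (q - 1) *\<^sub>m Q q) + (q - 1) *\<^sub>m R q"
    by (simp add: smult_mat_algebra)
  then show ?thesis
    unfolding B0_def Q_def[symmetric] W_def using matrix_inv_mult(1)[OF assms]
    by (simp only: smult_mat_algebra(3,6))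
qed

lemma eventually_invertible:
  "eventually (\<lambda>q. det (mat 1 + (q - 1) *\<^sub>m Q q) \<noteq> 0 \<and> det (mat 1 + (q - 1) *\<^sub>m W q) \<noteq> 0 \<and>
     det (mat 1 - ((q - 1) * (q * t / (1 - q * t))) *\<^sub>m W q) \<noteq> 0) (at 1)"
  using mnear_eventually_det[OF near_Y] mnear_eventually_det[OF near_V] mnear_eventually_det[OF near_Z]
  by (auto intro: eventually_conj)

lemma eventually_B0_eq:
  "eventually (\<lambda>q. B0 \<Theta>t \<Theta>inf A0 A1 t q = (- (q * t)) *\<^sub>m (mat 1 + (q - 1) *\<^sub>m W q)) (at 1)"
  using eventually_invertible by eventually_elim (simp add: B0_eq)

text \<open>For \<open>t\<close> different from 0 and 1, both this limit and its sum with
  \<open>mat 1\<close> are invertible. This yields the rationality of the corresponding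
  inverses.\<close>

lemma near_B0: "mnear (B0 \<Theta>t \<Theta>inf A0 A1 t) (- mat t)"
proof -
  have "mnear (\<lambda>q. (- (q * t)) *\<^sub>m (mat 1 + (q - 1) *\<^sub>m W q)) (- mat t)"
    by (rule mnear_rhs, (rule near_W near_intros | (insert t, simp; fail))+) (simp add: mat2_entrywise)
  then show ?thesis
    by (rule mnear_cong) (rule eventually_B0_eq)
qed

lemma near_qschlesinger_0:
  "mnear (qschlesinger_0 \<Theta>t \<Theta>inf A0 A1 t) (schlesinger_0 A0 (A_t \<theta>inf A0 A1) t)"
proof -
  have "mnear (\<lambda>q. (1 / t) *\<^sub>m ((W q ** A0 - A0 ** W q) ** matrix_inv (mat 1 + (q - 1) *\<^sub>m W q)))
      (schlesinger_0 A0 (A_t \<theta>inf A0 A1) t)"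
    by (rule mnear_rhs, (rule near_W near_inverse_V near_intros | (insert t, simp; fail))+)
       (use t in \<open>simp_all add: schlesinger_0_def commutator_def mat2_eq_iff field_simps\<close>)
  then show ?thesis
  proof (rule mnear_cong)
    show "eventually (\<lambda>q. qschlesinger_0 \<Theta>t \<Theta>inf A0 A1 t q
      = (1 / t) *\<^sub>m ((W q ** A0 - A0 ** W q) ** matrix_inv (mat 1 + (q - 1) *\<^sub>m W q))) (at 1)"
      using eventually_generic eventually_invertible eventually_B0_eq
    proof eventually_elim
      case (elim q)
      then show ?case
        using qschlesinger_0_exact[of "q - 1" q t _ _ "W q", OF _ _ t _ refl refl _ _ elim(3)]
        by (simp add: qschlesinger_0_def)
    qed
  qed
qed

text \<open>The term with \<open>m - 1\<close> vanishes in the limit, while \<open>u\<close> and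
  \<open>v\<close> share the limit \<open>t / (1 - t)\<close>; the two one-sided products therefore
  merge into a commutator.\<close>

lemma near_qschlesinger_1:
  "mnear (qschlesinger_1 \<Theta>t \<Theta>inf A0 A1 t) (schlesinger_1 A1 (A_t \<theta>inf A0 A1) t)"
proof -
  let ?u = "\<lambda>q. q * t / (1 - q * t)" and ?v = "t / (1 - t)"
    and ?m = "\<lambda>q. (t - 1)^2 * qquad \<Theta>t (q * t) q / ((q * t - 1)^2 * qquad \<Theta>t t q)"
  let ?F = "\<lambda>q. (1 / t) *\<^sub>m (((?m q - 1) / (q - 1)) *\<^sub>m
         ((mat 1 - ((q - 1) * ?v) *\<^sub>m W q) ** A1 ** matrix_inv (mat 1 - ((q - 1) * ?u q) *\<^sub>m W q))
       + (?u q *\<^sub>m (A1 ** W q) - ?v *\<^sub>m (W q ** A1)) ** matrix_inv (mat 1 - ((q - 1) * ?u q) *\<^sub>m W q))"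
  have "mnear ?F (schlesinger_1 A1 (A_t \<theta>inf A0 A1) t)"
    by (rule mnear_rhs, (rule near_mu near_W near_inverse_Z near_u near_intros | (insert t, simp; fail))+)
       (use t in \<open>simp_all add: schlesinger_1_def commutator_def smult_mat_algebra mat2_eq_iff\<close>)
  then show ?thesis
  proof (rule mnear_cong)
    show "eventually (\<lambda>q. qschlesinger_1 \<Theta>t \<Theta>inf A0 A1 t q = ?F q) (at 1)"
      using eventually_generic eventually_invertible eventually_B0_eq
    proof eventually_elim
      case (elim q)
      let ?k = "(t - 1) / (q * t - 1) * (qquad \<Theta>t (q * t) q / (q * qquad \<Theta>t t q))"
      have "?k * (q * (1 - t) / (1 - q * t)) = ?m q"
        using elim(1) by (simp add: divide_simps power2_eq_square) (simp add: algebra_simps)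
      then show ?case
        using qschlesinger_1_exact[of "q - 1" q t _ _ "W q" _ ?k A1, OF _ _ t _ refl refl _ _ elim(3)] elim
        by (simp add: qschlesinger_1_def)
    qed
  qed
qed

lemma schlesinger_t_eq:
  "schlesinger_t A0 A1 At t = (1 / t) *\<^sub>m (A0 ** At - At ** A0 - (t / (1 - t)) *\<^sub>m (A1 ** At - At ** A1))"
  using t by (simp add: schlesinger_t_def commutator_def mat2_eq_iff diff_divide_distrib ring_distribs)

text \<open>The quotient \<open>(W - qA_t) / (q - 1)\<close> has the limit
  \<open>-A_t (A0 + t/(t - 1) A1)\<close>. Its \<open>A0\<close> part cancels against
  \<open>W A0\<close>, and its \<open>A1\<close> part supplies the missing half of the commutator
  with \<open>A1\<close>.\<close>

lemma near_qschlesinger_t: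
  "mnear (qschlesinger_t \<Theta>t \<Theta>inf A0 A1 t) (schlesinger_t A0 A1 (A_t \<theta>inf A0 A1) t)"
proof -
  let ?u = "\<lambda>q. q * t / (1 - q * t)" and ?v = "t / (1 - t)"
    and ?d = "\<lambda>q. (1 - (t - 1)^2 / qquad \<Theta>t t q) / (q - 1)"
    and ?l = "\<lambda>q. qquad \<Theta>t (q * t) q"
  let ?F = "\<lambda>q. (1 / t) *\<^sub>m (?d q *\<^sub>m A1 - W q ** Q q + W q ** A0
         - (W q ** A0 - A0 ** W q) ** matrix_inv (mat 1 + (q - 1) *\<^sub>m W q)
       + ((t - 1)^2 / qquad \<Theta>t t q) *\<^sub>m ((mat 1 - ((q - 1) * ?v) *\<^sub>m W q) ** A1
          ** (((1 - ?l q / (q * t - 1)^2) / (q - 1)) *\<^sub>m mat 1 - ?u q *\<^sub>m W q)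
          ** matrix_inv (mat 1 - ((q - 1) * ?u q) *\<^sub>m W q)))"
  have minus: "t / (t - 1) = - (t / (1 - t))"
    by (metis minus_diff_eq minus_divide_right)
  have "mnear ?F (schlesinger_t A0 A1 (A_t \<theta>inf A0 A1) t)"
    by (rule mnear_rhs, (rule near_lambda near_R_minus_At near_W near_Q near_qquad_t
          near_inverse_V near_inverse_Z near_u near_intros | (insert t, simp; fail))+)
       (use t in \<open>simp_all add: schlesinger_t_eq minus smult_mat_algebra mat2_eq_iff algebra_simps\<close>)
  then show ?thesis
  proof (rule mnear_cong)
    show "eventually (\<lambda>q. qschlesinger_t \<Theta>t \<Theta>inf A0 A1 t q = ?F q) (at 1)"
      using eventually_generic eventually_invertible eventually_B0_eq
    proof eventually_elim
      case (elim q)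
      \<comment> \<open>Undoing the inverse in \<open>W\<close> gives
        \<open>W = R - (q - 1) W Q\<close>, which removes the last pole explicitly.\<close>
      have "W q ** (mat 1 + (q - 1) *\<^sub>m Q q) = R q"
        using matrix_inv_mult(2) elim(2) by (simp add: W_def matrix_mul_assoc[symmetric])
      then have "W q = R q - (q - 1) *\<^sub>m (W q ** Q q)"
        by (simp add: smult_mat_algebra algebra_simps)
      then have W: "(1 / (q - 1)) *\<^sub>m (W q - qA_t \<Theta>inf A0 A1 q) = ?d q *\<^sub>m A1 - W q ** Q q"
        using elim(1) by (simp add: R_def mat2_eq_iff) (simp add: field_simps)
      have c: "q * t * rat_eval \<Theta>t q * rat_eval (inverse \<Theta>t) q = q * t"
        using elim(1) by (simp add: mult.assoc)
      show ?case
        unfolding qschlesinger_t_def Let_def c W[symmetric]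
        by (rule qschlesinger_t_exact[OF _ _ t _ refl refl _ _ elim(3)]) (use elim in simp_all)
    qed
  qed
qed

lemma near_qschlesinger:
  "mnear (qschlesinger \<Theta>t \<Theta>inf k A0 A1 t) (schlesinger k A0 A1 (A_t \<theta>inf A0 A1) t)"
proof (cases k)
  case Res_0
  then show ?thesis
    by (auto intro: mnear_cong[OF near_qschlesinger_0])
next
  case Res_1
  then show ?thesis
    by (auto intro: mnear_cong[OF near_qschlesinger_1])
next
  case Res_t
  then show ?thesis
    by (auto intro: mnear_cong[OF near_qschlesinger_t])
qed

end

end

section \<open>Polynomial functions on the space of points\<close>

abbreviation pt_A0 :: "point \<Rightarrow> mat2" where "pt_A0 p \<equiv> fst p"
abbreviation pt_A1 :: "point \<Rightarrow> mat2" where "pt_A1 p \<equiv> fst (snd p)"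
abbreviation pt_t :: "point \<Rightarrow> complex" where "pt_t p \<equiv> fst (snd (snd p))"
abbreviation pt_q :: "point \<Rightarrow> complex" where "pt_q p \<equiv> snd (snd (snd p))"

definition at_q1 :: "point \<Rightarrow> point" where
  "at_q1 p = (pt_A0 p, pt_A1 p, pt_t p, 1)"

lemma at_q1_eq: "pt_q p = 1 \<Longrightarrow> at_q1 p = p"
  by (simp add: at_q1_def prod_eq_iff)

lemma at_q1_Pair [simp]: "at_q1 (A0, A1, t, q) = (A0, A1, t, 1)"
  by (simp add: at_q1_def)

lemma pt_q_at_q1 [simp]: "pt_q (at_q1 p) = 1"
  by (simp add: at_q1_def)

named_theorems polyfun_intros

lemma polyfun_coordinates [polyfun_intros]:
  "polyfun (\<lambda>p. pt_A0 p $ i $ j)" "polyfun (\<lambda>p. pt_A1 p $ i $ j)" "polyfun (\<lambda>p. pt_t p)" "polyfun (\<lambda>p. pt_q p)"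
  using polyfun_A0[of i j] polyfun_A1[of i j] polyfun_t polyfun_q by (simp_all add: case_prod_unfold)

lemmas [polyfun_intros] = polyfun_const polyfun_add polyfun_mult

lemma polyfun_uminus [polyfun_intros]: "polyfun F \<Longrightarrow> polyfun (\<lambda>p. - F p)"
  using polyfun_mult[OF polyfun_const[of "-1"], of F] by simp

lemma polyfun_diff [polyfun_intros]: "polyfun F \<Longrightarrow> polyfun G \<Longrightarrow> polyfun (\<lambda>p. F p - G p)"
  using polyfun_add[OF _ polyfun_uminus, of F G] by simp

lemma polyfun_power [polyfun_intros]: "polyfun F \<Longrightarrow> polyfun (\<lambda>p. F p ^ n)"
  by (induction n) (auto intro: polyfun_intros)

lemma polyfun_prod: "(\<And>k. k \<in> S \<Longrightarrow> polyfun (F k)) \<Longrightarrow> polyfun (\<lambda>p. \<Prod>k\<in>S. F k p)"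
  by (induction S rule: infinite_finite_induct) (auto intro: polyfun_intros)

lemma polyfun_poly [polyfun_intros]: "polyfun F \<Longrightarrow> polyfun (\<lambda>p. poly P (F p))"
  by (induction P) (auto intro: polyfun_intros)

text \<open>The line parameter is real because it acts through \<open>*\<^sub>R\<close>. A nonzero
  complex polynomial still has only finitely many real zeros.\<close>

lemma polyfun_poly_along_line:
  assumes "polyfun F"
  shows "\<exists>P. \<forall>s. F (a + s *\<^sub>R d) = poly P (of_real s)"
  using assms
proof induction
  case (polyfun_const c)
  show ?case by (intro exI[of _ "[:c:]"]) simp
next
  case (polyfun_A0 i j)
  show ?case by (intro exI[of _ "[:pt_A0 a $ i $ j, pt_A0 d $ i $ j:]"])
      (simp add: case_prod_unfold, simp add: scaleR_conv_of_real)
next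
  case (polyfun_A1 i j)
  show ?case by (intro exI[of _ "[:pt_A1 a $ i $ j, pt_A1 d $ i $ j:]"])
      (simp add: case_prod_unfold, simp add: scaleR_conv_of_real)
next
  case polyfun_t
  show ?case by (intro exI[of _ "[:pt_t a, pt_t d:]"]) (simp add: case_prod_unfold, simp add: scaleR_conv_of_real)
next
  case polyfun_q
  show ?case by (intro exI[of _ "[:pt_q a, pt_q d:]"]) (simp add: case_prod_unfold, simp add: scaleR_conv_of_real)
next
  case (polyfun_add F G)
  then show ?case by (metis poly_add)
next
  case (polyfun_mult F G)
  then show ?case by (metis poly_mult)
qed

lemma polyfun_poly_in_q:
  assumes "polyfun F"
  shows "\<exists>P. \<forall>q. F (A0, A1, t, q) = poly P q"
  using assms
proof induction
  case (polyfun_const c)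
  show ?case by (intro exI[of _ "[:c:]"]) simp
next
  case (polyfun_A0 i j)
  show ?case by (intro exI[of _ "[:A0 $ i $ j:]"]) simp
next
  case (polyfun_A1 i j)
  show ?case by (intro exI[of _ "[:A1 $ i $ j:]"]) simp
next
  case polyfun_t
  show ?case by (intro exI[of _ "[:t:]"]) simp
next
  case polyfun_q
  show ?case by (intro exI[of _ "[:0, 1:]"]) simp
next
  case (polyfun_add F G)
  then show ?case by (metis poly_add)
next
  case (polyfun_mult F G)
  then show ?case by (metis poly_mult)
qed

text \<open>On the real line through a nonzero of \<open>F\<close> and a nonzero of \<open>G\<close> both functions have only
  finitely many zeros.\<close>

lemma polyfun_common_nonzero:
  assumes "polyfun F" "polyfun G" "F a \<noteq> 0" "G b \<noteq> 0"
  obtains s where "F (a + s *\<^sub>R (b - a)) \<noteq> 0" "G (a + s *\<^sub>R (b - a)) \<noteq> 0"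
proof -
  obtain P where P: "F (a + s *\<^sub>R (b - a)) = poly P (of_real s)" for s
    using polyfun_poly_along_line[OF assms(1)] by metis
  obtain R where R: "G (a + s *\<^sub>R (b - a)) = poly R (of_real s)" for s
    using polyfun_poly_along_line[OF assms(2)] by metis
  have "P \<noteq> 0" "R \<noteq> 0"
    using assms(3,4) P[of 0] R[of 1] by auto
  then have "finite {z. poly (P * R) z = 0}"
    by (intro poly_roots_finite) simp
  moreover have "infinite (range complex_of_real)"
    by (simp add: finite_image_iff inj_of_real infinite_UNIV_char_0)
  ultimately obtain s where "poly (P * R) (of_real s) \<noteq> 0"
    by (metis (mono_tags, lifting) finite_subset image_subsetI mem_Collect_eq)
  then show thesis
    by (intro that[of s]) (auto simp: P R)
qed

text \<open>The set \<open>q = 1\<close> is an affine hyperplane, so the line joining two of its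
  points stays inside it.\<close>

lemma polyfun_common_nonzero_at_q1:
  assumes "polyfun F" "polyfun G" "F a \<noteq> 0" "G b \<noteq> 0" "pt_q a = 1" "pt_q b = 1"
  obtains c where "F c \<noteq> 0" "G c \<noteq> 0" "pt_q c = 1"
proof -
  obtain s where "F (a + s *\<^sub>R (b - a)) \<noteq> 0" "G (a + s *\<^sub>R (b - a)) \<noteq> 0"
    using polyfun_common_nonzero[OF assms(1-4)] .
  then show thesis
    using assms(5,6) by (intro that[of "a + s *\<^sub>R (b - a)"]) simp_all
qed

section \<open>Divisibility by \<open>q - 1\<close>\<close>

lemma polyfun_at_q1:
  assumes "polyfun F"
  shows "polyfun (\<lambda>p. F (at_q1 p))"
  using assms
  by induction (auto simp: at_q1_def intro: polyfun_intros)

text \<open>Division with remainder by \<open>q - 1\<close>. Polynomials exist here only as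
  functions, so the quotient is built along the inductive definition; products use the discrete
  Leibniz rule.\<close>

lemma polyfun_div_q_minus_1:
  assumes "polyfun F"
  shows "\<exists>G. polyfun G \<and> (\<forall>p. F p = F (at_q1 p) + (pt_q p - 1) * G p)"
  using assms
proof induction
  case (polyfun_mult F H)
  then obtain G K where G: "polyfun G" "\<And>p. F p = F (at_q1 p) + (pt_q p - 1) * G p"
    and K: "polyfun K" "\<And>p. H p = H (at_q1 p) + (pt_q p - 1) * K p"
    by blast
  show ?case
  proof (intro exI conjI allI)
    show "polyfun (\<lambda>p. G p * H p + F (at_q1 p) * K p)"
      by (intro polyfun_intros G K polyfun_mult.hyps polyfun_at_q1[OF polyfun_mult.hyps(1)])
    show "F p * H p = F (at_q1 p) * H (at_q1 p) + (pt_q p - 1) * (G p * H p + F (at_q1 p) * K p)" for p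
      using G(2)[of p] K(2)[of p] by algebra
  qed
next
  case (polyfun_add F H)
  then obtain G K where G: "polyfun G" "\<And>p. F p = F (at_q1 p) + (pt_q p - 1) * G p"
    and K: "polyfun K" "\<And>p. H p = H (at_q1 p) + (pt_q p - 1) * K p"
    by blast
  show ?case
  proof (intro exI conjI allI)
    show "polyfun (\<lambda>p. G p + K p)"
      by (intro polyfun_intros G K)
    show "F p + H p = F (at_q1 p) + H (at_q1 p) + (pt_q p - 1) * (G p + K p)" for p
      using G(2)[of p] K(2)[of p] by algebra
  qed
next
  case polyfun_q
  show ?case by (intro exI[of _ "\<lambda>_. 1"]) (auto simp: at_q1_def intro: polyfun_intros)
qed (intro exI[of _ "\<lambda>_. 0"], auto simp: at_q1_def intro: polyfun_intros)+

text \<open>Factors \<open>q - 1\<close> are split off while the function vanishes on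
  \<open>q = 1\<close>. The process stops because each one lowers the degree in \<open>q\<close>
  along the line through \<open>p\<close>, where the function is not identically zero.\<close>

lemma polyfun_order_at_q1:
  assumes "polyfun F" "F p \<noteq> 0"
  shows "\<exists>n G. polyfun G \<and> (\<forall>p. F p = (pt_q p - 1) ^ n * G p) \<and> (\<exists>b. G b \<noteq> 0 \<and> pt_q b = 1)"
proof -
  obtain A0 A1 t q where p: "p = (A0, A1, t, q)"
    by (cases p) auto
  have "\<exists>n G. polyfun G \<and> (\<forall>p. F p = (pt_q p - 1) ^ n * G p) \<and> (\<exists>b. G b \<noteq> 0 \<and> pt_q b = 1)"
    if "polyfun F" "P \<noteq> 0" "\<And>q. F (A0, A1, t, q) = poly P q" for F P
    using that
  proof (induction "degree P" arbitrary: F P rule: less_induct)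
    case less
    show ?case
    proof (cases "\<exists>b. F b \<noteq> 0 \<and> pt_q b = 1")
      case True
      then show ?thesis
        using less.prems(1) by (intro exI[of _ 0] exI[of _ F]) simp
    next
      case False
      then have "F (at_q1 p) = 0" for p
        by (metis pt_q_at_q1)
      then obtain G where G: "polyfun G" "\<And>p. F p = (pt_q p - 1) * G p"
        using polyfun_div_q_minus_1[OF less.prems(1)] by (metis add_0)
      obtain R where R: "G (A0, A1, t, q) = poly R q" for q
        using polyfun_poly_in_q[OF G(1)] by blast
      have "poly P = poly ([:-1, 1:] * R)"
        using less.prems(3) G(2) R by (auto simp: fun_eq_iff algebra_simps)
      then have P: "P = [:-1, 1:] * R"
        by (simp only: poly_eq_poly_eq_iff)
      then have "R \<noteq> 0"
        using less.prems(2) by auto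
      then have "degree R < degree P"
        unfolding P by (subst degree_mult_eq) auto
      from less.hyps[OF this G(1) \<open>R \<noteq> 0\<close> R]
      obtain n K where "polyfun K" "\<And>p. G p = (pt_q p - 1) ^ n * K p" "\<exists>b. K b \<noteq> 0 \<and> pt_q b = 1"
        by blast
      then show ?thesis
        using G(2) by (intro exI[of _ "Suc n"] exI[of _ K]) simp
    qed
  qed
  moreover obtain P where "\<And>q. F (A0, A1, t, q) = poly P q"
    using polyfun_poly_in_q[OF assms(1)] by blast
  ultimately show ?thesis
    using assms p by (metis poly_0)
qed

section \<open>Generic points and rational functions\<close>

text \<open>The Zariski-open condition inside \<open>represents\<close>, isolated so that generic
  statements can be combined.\<close>

definition generic :: "(point \<Rightarrow> bool) \<Rightarrow> bool" where
  "generic P \<longleftrightarrow> (\<exists>E. polyfun E \<and> (\<exists>p. E p \<noteq> 0) \<and> (\<forall>p. E p \<noteq> 0 \<longrightarrow> P p))"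

lemma represents_iff:
  "represents N D F \<longleftrightarrow> polyfun N \<and> polyfun D \<and> generic (\<lambda>p. D p \<noteq> 0 \<and> F p = N p / D p)"
  by (simp add: represents_def generic_def)

lemma generic_mono: "generic P \<Longrightarrow> (\<And>p. P p \<Longrightarrow> Q p) \<Longrightarrow> generic Q"
  unfolding generic_def by blast

lemma generic_always: "(\<And>p. P p) \<Longrightarrow> generic P"
  unfolding generic_def by (intro exI[of _ "\<lambda>_. 1"]) (auto intro: polyfun_intros)

lemma generic_polyfun: "polyfun F \<Longrightarrow> F p \<noteq> 0 \<Longrightarrow> generic (\<lambda>p. F p \<noteq> 0)"
  unfolding generic_def by blast

text \<open>Irreducibility of affine space: the product of two nonzero polynomial functions is
  nonzero.\<close>

lemma generic_conj:
  assumes "generic P" "generic Q"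
  shows "generic (\<lambda>p. P p \<and> Q p)"
proof -
  obtain E a where E: "polyfun E" "E a \<noteq> 0" "\<And>p. E p \<noteq> 0 \<Longrightarrow> P p"
    using assms(1) unfolding generic_def by blast
  obtain G b where G: "polyfun G" "G b \<noteq> 0" "\<And>p. G p \<noteq> 0 \<Longrightarrow> Q p"
    using assms(2) unfolding generic_def by blast
  obtain s where "E (a + s *\<^sub>R (b - a)) \<noteq> 0" "G (a + s *\<^sub>R (b - a)) \<noteq> 0"
    using polyfun_common_nonzero[OF E(1) G(1) E(2) G(2)] .
  then have "\<exists>c. E c * G c \<noteq> 0"
    by (metis mult_eq_0_iff)
  then show ?thesis
    unfolding generic_def using E G
    by (intro exI[of _ "\<lambda>p. E p * G p"] conjI) (auto intro: polyfun_intros)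
qed

text \<open>A generic property may fail on all of \<open>q = 1\<close>, but it can be reached by
  letting \<open>q\<close> tend to 1. Choose a point where \<open>E\<close> and \<open>H\<close>
  composed with \<open>at_q1\<close> are both nonzero and freeze all coordinates except
  \<open>q\<close>: then \<open>E\<close> is a nonzero polynomial in \<open>q\<close>.\<close>

lemma generic_near_q1:
  assumes "generic P" "polyfun H" "H a \<noteq> 0" "pt_q a = 1"
  obtains A0 A1 t where "H (A0, A1, t, 1) \<noteq> 0" "eventually (\<lambda>q. P (A0, A1, t, q)) (at 1)"
proof -
  obtain E b where E: "polyfun E" "E b \<noteq> 0" "\<And>p. E p \<noteq> 0 \<Longrightarrow> P p"
    using assms(1) unfolding generic_def by blast
  have "H (at_q1 a) \<noteq> 0"
    using assms by (simp add: at_q1_eq)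
  then obtain s where s: "H (at_q1 (a + s *\<^sub>R (b - a))) \<noteq> 0" "E (a + s *\<^sub>R (b - a)) \<noteq> 0"
    using polyfun_common_nonzero[OF polyfun_at_q1[OF assms(2)] E(1) _ E(2), of a] by blast
  obtain A0 A1 t q where c: "a + s *\<^sub>R (b - a) = (A0, A1, t, q)"
    using prod_cases4 by blast
  obtain R where R: "E (A0, A1, t, q) = poly R q" for q
    using polyfun_poly_in_q[OF E(1)] by blast
  have "R \<noteq> 0"
    using s(2) R[of q] unfolding c by auto
  then have "eventually (\<lambda>q. poly R q \<noteq> 0) (at 1)"
    by (rule eventually_poly_neq_0)
  then have "eventually (\<lambda>q. P (A0, A1, t, q)) (at 1)"
    by (rule eventually_mono) (use E(3) R in metis)
  with s(1) show thesis
    unfolding c by (intro that) simp_all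
qed

lemma polyfun_tendsto_q1:
  assumes "polyfun F"
  shows "((\<lambda>q. F (A0, A1, t, q)) \<longlongrightarrow> F (A0, A1, t, 1)) (at 1)"
proof -
  obtain P where "F (A0, A1, t, q) = poly P q" for q
    using polyfun_poly_in_q[OF assms] by blast
  then show ?thesis
    by (auto intro!: tendsto_intros)
qed

section \<open>Closure properties of rational functions\<close>

named_theorems rational_intros

lemma rational_fun_cong:
  assumes "rational_fun F" "generic (\<lambda>p. G p = F p)"
  shows "rational_fun G"
proof -
  obtain N D where "polyfun N" "polyfun D" "generic (\<lambda>p. D p \<noteq> 0 \<and> F p = N p / D p)"
    using assms(1) unfolding rational_fun_def represents_iff by blast
  moreover from generic_conj[OF this(3) assms(2)]
  have "generic (\<lambda>p. D p \<noteq> 0 \<and> G p = N p / D p)"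
    by (rule generic_mono) auto
  ultimately show ?thesis
    unfolding rational_fun_def represents_iff by blast
qed

lemma rational_fun_polyfun: "polyfun F \<Longrightarrow> rational_fun F"
  unfolding rational_fun_def represents_iff
  by (intro exI[of _ F] exI[of _ "\<lambda>_. 1"]) (auto intro: polyfun_intros generic_always)

lemmas rational_coordinates [rational_intros] = polyfun_coordinates[THEN rational_fun_polyfun]
lemmas rational_fun_const [rational_intros] = polyfun_const[THEN rational_fun_polyfun]

lemma rational_fun_add [rational_intros]:
  assumes "rational_fun F" "rational_fun G"
  shows "rational_fun (\<lambda>p. F p + G p)"
proof -
  obtain N D where F: "polyfun N" "polyfun D" "generic (\<lambda>p. D p \<noteq> 0 \<and> F p = N p / D p)"
    using assms(1) unfolding rational_fun_def represents_iff by blast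
  obtain M E where G: "polyfun M" "polyfun E" "generic (\<lambda>p. E p \<noteq> 0 \<and> G p = M p / E p)"
    using assms(2) unfolding rational_fun_def represents_iff by blast
  from generic_conj[OF F(3) G(3)]
  have "generic (\<lambda>p. D p * E p \<noteq> 0 \<and> F p + G p = (N p * E p + M p * D p) / (D p * E p))"
    by (rule generic_mono) (simp add: add_frac_eq)
  then show ?thesis
    unfolding rational_fun_def represents_iff
    by (intro exI[of _ "\<lambda>p. N p * E p + M p * D p"] exI[of _ "\<lambda>p. D p * E p"] conjI polyfun_intros F G)
qed

lemma rational_fun_mult [rational_intros]:
  assumes "rational_fun F" "rational_fun G"
  shows "rational_fun (\<lambda>p. F p * G p)"
proof -
  obtain N D where F: "polyfun N" "polyfun D" "generic (\<lambda>p. D p \<noteq> 0 \<and> F p = N p / D p)"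
    using assms(1) unfolding rational_fun_def represents_iff by blast
  obtain M E where G: "polyfun M" "polyfun E" "generic (\<lambda>p. E p \<noteq> 0 \<and> G p = M p / E p)"
    using assms(2) unfolding rational_fun_def represents_iff by blast
  from generic_conj[OF F(3) G(3)]
  have "generic (\<lambda>p. D p * E p \<noteq> 0 \<and> F p * G p = (N p * M p) / (D p * E p))"
    by (rule generic_mono) simp
  then show ?thesis
    unfolding rational_fun_def represents_iff
    by (intro exI[of _ "\<lambda>p. N p * M p"] exI[of _ "\<lambda>p. D p * E p"] conjI polyfun_intros F G)
qed

lemma rational_fun_uminus [rational_intros]: "rational_fun F \<Longrightarrow> rational_fun (\<lambda>p. - F p)"
  using rational_fun_mult[OF rational_fun_const[of "-1"], of F] by simp

lemma rational_fun_diff [rational_intros]: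
  "rational_fun F \<Longrightarrow> rational_fun G \<Longrightarrow> rational_fun (\<lambda>p. F p - G p)"
  using rational_fun_add[OF _ rational_fun_uminus, of F G] by simp

lemma rational_fun_power [rational_intros]: "rational_fun F \<Longrightarrow> rational_fun (\<lambda>p. F p ^ n)"
  by (induction n) (auto intro: rational_intros)

text \<open>If \<open>F\<close> is generically zero, then so is its HOL inverse, as \<open>inverse 0 = 0\<close>.\<close>

lemma rational_fun_inverse [rational_intros]:
  assumes "rational_fun F"
  shows "rational_fun (\<lambda>p. inverse (F p))"
proof -
  obtain N D where F: "polyfun N" "polyfun D" "generic (\<lambda>p. D p \<noteq> 0 \<and> F p = N p / D p)"
    using assms(1) unfolding rational_fun_def represents_iff by blast
  show ?thesis
  proof (cases "\<exists>p. N p \<noteq> 0")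
    case True
    then have "generic (\<lambda>p. N p \<noteq> 0)"
      using F(1) generic_polyfun by blast
    from generic_conj[OF this F(3)]
    have "generic (\<lambda>p. N p \<noteq> 0 \<and> inverse (F p) = D p / N p)"
      by (rule generic_mono) auto
    then show ?thesis
      unfolding rational_fun_def represents_iff using F by blast
  next
    case False
    with F(3) have "generic (\<lambda>p. inverse (F p) = 0)"
      by (auto elim: generic_mono)
    then show ?thesis
      by (rule rational_fun_cong[OF rational_fun_const])
  qed
qed

lemma rational_fun_divide [rational_intros]:
  "rational_fun F \<Longrightarrow> rational_fun G \<Longrightarrow> rational_fun (\<lambda>p. F p / G p)"
  unfolding divide_inverse by (intro rational_intros)

lemma rational_fun_rat_eval [rational_intros]: "rational_fun (\<lambda>p. rat_eval r (pt_q p))"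
  unfolding rat_eval_def by (intro rational_fun_divide rational_fun_polyfun polyfun_intros)

section \<open>Matrices of rational functions\<close>

definition rational_mat :: "(point \<Rightarrow> mat2) \<Rightarrow> bool" where
  "rational_mat M \<longleftrightarrow> (\<forall>i j. rational_fun (\<lambda>p. M p $ i $ j))"

lemma rational_mat_coordinates [rational_intros]: "rational_mat pt_A0" "rational_mat pt_A1"
  by (simp_all add: rational_mat_def rational_intros)

lemma rational_mat_add [rational_intros]:
  "rational_mat M \<Longrightarrow> rational_mat N \<Longrightarrow> rational_mat (\<lambda>p. M p + N p)"
  by (simp add: rational_mat_def rational_intros)

lemma rational_mat_diff [rational_intros]:
  "rational_mat M \<Longrightarrow> rational_mat N \<Longrightarrow> rational_mat (\<lambda>p. M p - N p)"
  by (simp add: rational_mat_def rational_intros)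

lemma rational_mat_uminus [rational_intros]: "rational_mat M \<Longrightarrow> rational_mat (\<lambda>p. - M p)"
  by (simp add: rational_mat_def rational_intros)

lemma rational_mat_smult [rational_intros]:
  "rational_fun F \<Longrightarrow> rational_mat M \<Longrightarrow> rational_mat (\<lambda>p. F p *\<^sub>m M p)"
  by (simp add: rational_mat_def rational_intros)

lemma rational_mat_mult [rational_intros]:
  "rational_mat M \<Longrightarrow> rational_mat N \<Longrightarrow> rational_mat (\<lambda>p. M p ** N p)"
  by (simp add: rational_mat_def mat2_mult_nth rational_intros)

lemma rational_mat_mat [rational_intros]: "rational_fun F \<Longrightarrow> rational_mat (\<lambda>p. mat (F p))"
  by (simp add: rational_mat_def forall_2 mat_nth rational_fun_const)

lemma rational_mat_diag2 [rational_intros]: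
  "rational_fun F \<Longrightarrow> rational_fun G \<Longrightarrow> rational_mat (\<lambda>p. diag2 (F p) (G p))"
  by (simp add: rational_mat_def forall_2 diag2_nth rational_fun_const)

text \<open>If the determinant vanished generically, it would vanish for all \<open>q\<close> near 1
  at some admissible \<open>(A0, A1, t)\<close>, against the hypothesis. Hence the adjugate formula
  is valid generically.\<close>

lemma rational_mat_matrix_inv:
  assumes M: "rational_mat M"
    and det: "\<And>A0 A1 t. t \<noteq> 0 \<Longrightarrow> t \<noteq> 1 \<Longrightarrow> eventually (\<lambda>q. det (M (A0, A1, t, q)) \<noteq> 0) (at 1)"
  shows "rational_mat (\<lambda>p. matrix_inv (M p))"
proof -
  have entries: "rational_fun (\<lambda>p. M p $ i $ j)" for i j
    using M by (simp add: rational_mat_def)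
  have rdet: "rational_fun (\<lambda>p. det (M p))"
    unfolding det_2 by (intro rational_intros entries)
  then obtain N D where ND: "polyfun N" "polyfun D" "generic (\<lambda>p. D p \<noteq> 0 \<and> det (M p) = N p / D p)"
    unfolding rational_fun_def represents_iff by blast
  have "\<exists>p. N p \<noteq> 0"
  proof (rule ccontr)
    assume "\<nexists>p. N p \<noteq> 0"
    then have "generic (\<lambda>p. det (M p) = 0)"
      using ND(3) by (auto elim: generic_mono)
    then obtain A0 A1 t where t: "t * (t - 1) \<noteq> 0"
      and zero: "eventually (\<lambda>q. det (M (A0, A1, t, q)) = 0) (at 1)"
      \<comment> \<open>Any point with \<open>q = 1\<close> and \<open>t\<close> different from 0
        and 1 would serve; here \<open>t = 2\<close>.\<close>
      using generic_near_q1[of "\<lambda>p. det (M p) = 0" "\<lambda>p. pt_t p * (pt_t p - 1)" "(0, 0, 2, 1)"]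
      by (force intro: polyfun_intros)
    from t have "eventually (\<lambda>q. det (M (A0, A1, t, q)) \<noteq> 0) (at 1)"
      by (intro det) auto
    with zero have "eventually (\<lambda>_. False) (at (1::complex))"
      by (rule eventually_elim2) simp
    then show False
      by simp
  qed
  then have "generic (\<lambda>p. N p \<noteq> 0)"
    using ND(1) generic_polyfun by blast
  from generic_conj[OF this ND(3)]
  have *: "generic (\<lambda>p. matrix_inv (M p) = (1 / det (M p)) *\<^sub>m adjugate2 (M p))"
    by (rule generic_mono) (rule matrix_inv_eq_adjugate2, simp)
  have "rational_mat (\<lambda>p. adjugate2 (M p))"
    by (simp add: rational_mat_def forall_2 adjugate2_nth rational_intros entries)
  then have "rational_mat (\<lambda>p. (1 / det (M p)) *\<^sub>m adjugate2 (M p))"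
    by (intro rational_intros rdet)
  then have "rational_fun (\<lambda>p. ((1 / det (M p)) *\<^sub>m adjugate2 (M p)) $ i $ j)" for i j
    unfolding rational_mat_def by blast
  moreover have "generic (\<lambda>p. matrix_inv (M p) $ i $ j = ((1 / det (M p)) *\<^sub>m adjugate2 (M p)) $ i $ j)" for i j
    using * by (rule generic_mono) simp
  ultimately have "rational_fun (\<lambda>p. matrix_inv (M p) $ i $ j)" for i j
    by (rule rational_fun_cong)
  then show ?thesis
    unfolding rational_mat_def by blast
qed

section \<open>Regularity along \<open>q = 1\<close>\<close>

text \<open>Write \<open>D = (q - 1)^n G\<close> with \<open>G\<close> not vanishing identically on
  \<open>q = 1\<close>. If \<open>n > 0\<close>, finiteness of the limits forces the numerator to
  vanish on \<open>q = 1\<close>, so one factor cancels; induct on \<open>n\<close>.\<close>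

lemma represents_regular_at_q1:
  assumes F: "rational_fun F"
    and lim: "\<And>A0 A1 t. t \<noteq> 0 \<Longrightarrow> t \<noteq> 1 \<Longrightarrow> \<exists>l. ((\<lambda>q. F (A0, A1, t, q)) \<longlongrightarrow> l) (at 1)"
  shows "\<exists>N D b. represents N D F \<and> D b \<noteq> 0 \<and> pt_q b = 1"
proof -
  obtain N D where ND: "represents N D F"
    using F unfolding rational_fun_def by blast
  then obtain p where "D p \<noteq> 0" "polyfun D"
    unfolding represents_iff generic_def by blast
  then obtain n G b where G: "polyfun G" "\<And>p. D p = (pt_q p - 1) ^ n * G p" "G b \<noteq> 0" "pt_q b = 1"
    using polyfun_order_at_q1 by blast
  have "represents N (\<lambda>p. (pt_q p - 1) ^ n * G p) F \<Longrightarrow> ?thesis" for N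
  proof (induction n arbitrary: N)
    case 0
    then show ?case
      using G(3,4) by (intro exI[of _ N] exI[of _ G] exI[of _ b]) simp
  next
    case (Suc n)
    have N: "polyfun N" "generic (\<lambda>p. (pt_q p - 1) ^ Suc n * G p \<noteq> 0 \<and> F p = N p / ((pt_q p - 1) ^ Suc n * G p))"
      using Suc.prems by (auto simp: represents_iff)
    have N0: "N a = 0" if q1: "pt_q a = 1" for a
    proof (rule ccontr)
      assume "N a \<noteq> 0"
      \<comment> \<open>The factor \<open>t (t - 1)\<close> keeps the chosen point in the region
        where the limits exist.\<close>
      define H where "H = (\<lambda>p. N p * (pt_t p * (pt_t p - 1)))"
      have H: "polyfun H" and t_factor: "polyfun (\<lambda>p. pt_t p * (pt_t p - 1))"
        unfolding H_def by (intro polyfun_intros N)+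
      obtain a' where "N a' \<noteq> 0" "pt_t a' * (pt_t a' - 1) \<noteq> 0" and a': "pt_q a' = 1"
        by (rule polyfun_common_nonzero_at_q1[OF N(1) t_factor \<open>N a \<noteq> 0\<close>, of "(0, 0, 2, 1)"])
           (simp_all add: q1)
      then have "H a' \<noteq> 0"
        by (simp add: H_def)
      obtain A0 A1 t where t: "H (A0, A1, t, 1) \<noteq> 0"
        "eventually (\<lambda>q. (q - 1) ^ Suc n * G (A0, A1, t, q) \<noteq> 0 \<and>
            F (A0, A1, t, q) = N (A0, A1, t, q) / ((q - 1) ^ Suc n * G (A0, A1, t, q))) (at 1)"
        by (rule generic_near_q1[where H = H and a = a', OF N(2) H \<open>H a' \<noteq> 0\<close> a']) simp
      obtain l where l: "((\<lambda>q. F (A0, A1, t, q)) \<longlongrightarrow> l) (at 1)"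
        using lim[of t A0 A1] t(1) by (auto simp: H_def)
      have "((\<lambda>q. F (A0, A1, t, q) * ((q - 1) ^ Suc n * G (A0, A1, t, q)))
          \<longlongrightarrow> l * ((1 - 1) ^ Suc n * G (A0, A1, t, 1))) (at 1)"
        by (intro tendsto_intros l polyfun_tendsto_q1 G)
      moreover have "eventually (\<lambda>q. F (A0, A1, t, q) * ((q - 1) ^ Suc n * G (A0, A1, t, q)) = N (A0, A1, t, q)) (at 1)"
        using t(2) by eventually_elim simp
      ultimately have "((\<lambda>q. N (A0, A1, t, q)) \<longlongrightarrow> 0) (at 1)"
        using tendsto_cong by fastforce
      then have "N (A0, A1, t, 1) = 0"
        using polyfun_tendsto_q1[OF N(1)] tendsto_unique trivial_limit_at by blast
      then show False
        using t(1) by (simp add: H_def)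
    qed
    obtain M where M: "polyfun M" "\<And>p. N p = (pt_q p - 1) * M p"
      using polyfun_div_q_minus_1[OF N(1)] N0 by (metis add_0 pt_q_at_q1)
    from N(2) have "generic (\<lambda>p. (pt_q p - 1) ^ n * G p \<noteq> 0 \<and> F p = M p / ((pt_q p - 1) ^ n * G p))"
      by (rule generic_mono) (auto simp: M(2))
    then have "represents M (\<lambda>p. (pt_q p - 1) ^ n * G p) F"
      unfolding represents_iff by (intro conjI polyfun_intros M G)
    then show ?case
      by (rule Suc.IH)
  qed
  moreover have "D = (\<lambda>p. (pt_q p - 1) ^ n * G p)"
    using G(2) by auto
  ultimately show ?thesis
    using ND by blast
qed

text \<open>It provides a single point of \<open>q = 1\<close> outside finitely many polar loci at
  once.\<close>

lemma common_nonzero_at_q1: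
  assumes "finite S" "\<And>k. k \<in> S \<Longrightarrow> polyfun (D k) \<and> (\<exists>b. D k b \<noteq> 0 \<and> pt_q b = 1)"
  shows "\<exists>b. pt_q b = 1 \<and> (\<forall>k\<in>S. D k b \<noteq> 0)"
proof -
  have "\<exists>b. pt_q b = 1 \<and> (\<Prod>k\<in>S. D k b) \<noteq> 0"
    using assms
  proof (induction S rule: finite_induct)
    case empty
    show ?case by (intro exI[of _ "(0, 0, 0, 1)"]) simp
  next
    case (insert k S)
    obtain a where a: "pt_q a = 1" "(\<Prod>k\<in>S. D k a) \<noteq> 0"
      using insert by auto
    obtain b where b: "D k b \<noteq> 0" "pt_q b = 1"
      using insert.prems by blast
    obtain c where "D k c \<noteq> 0" "(\<Prod>k\<in>S. D k c) \<noteq> 0" "pt_q c = 1"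
      using polyfun_common_nonzero_at_q1[of "D k" "\<lambda>p. \<Prod>k\<in>S. D k p" b a] polyfun_prod[of S D]
        insert.prems a b by blast
    then show ?case
      using insert.hyps by (intro exI[of _ c]) simp
  qed
  then show ?thesis
    using assms(1) by auto
qed

text \<open>The identity \<open>F = N / D\<close> may fail near the given point, so the limit cannot
  be taken there. Instead \<open>h D - N\<close>, made polynomial on \<open>q = 1\<close> by means
  of \<open>K\<close>, would be nonzero at a nearby-generic point too, where the limit does apply
  and shows that it vanishes.\<close>

lemma represents_value_at_q1:
  assumes ND: "represents N D F" and D: "D (A0, A1, t, 1) \<noteq> 0" and t: "t \<noteq> 0" "t \<noteq> 1"
    and lim: "\<And>A0 A1 t. t \<noteq> 0 \<Longrightarrow> t \<noteq> 1 \<Longrightarrow> ((\<lambda>q. F (A0, A1, t, q)) \<longlongrightarrow> h A0 A1 t) (at 1)"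
    and K: "polyfun K" "\<And>A0 A1 t. t \<noteq> 0 \<Longrightarrow> t \<noteq> 1 \<Longrightarrow> t * (t - 1) * h A0 A1 t = K (A0, A1, t, 1)"
  shows "h A0 A1 t = N (A0, A1, t, 1) / D (A0, A1, t, 1)"
proof (rule ccontr)
  define H where "H = (\<lambda>p. (K p * D p - pt_t p * (pt_t p - 1) * N p) * (pt_t p * (pt_t p - 1)))"
  have H_eq: "H (A0, A1, t, 1) = (t * (t - 1))^2 * (h A0 A1 t * D (A0, A1, t, 1) - N (A0, A1, t, 1))"
    if "t \<noteq> 0" "t \<noteq> 1" for A0 A1 t
    unfolding H_def fst_conv snd_conv K(2)[OF that, symmetric] by algebra
  assume "h A0 A1 t \<noteq> N (A0, A1, t, 1) / D (A0, A1, t, 1)"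
  then have nz: "H (A0, A1, t, 1) \<noteq> 0"
    using D t by (simp add: H_eq field_simps)
  have N: "polyfun N" "polyfun D" "generic (\<lambda>p. D p \<noteq> 0 \<and> F p = N p / D p)"
    using ND by (auto simp: represents_iff)
  have "polyfun H"
    unfolding H_def by (intro polyfun_intros N K)
  then obtain C0 C1 s where s: "H (C0, C1, s, 1) \<noteq> 0"
    "eventually (\<lambda>q. D (C0, C1, s, q) \<noteq> 0 \<and> F (C0, C1, s, q) = N (C0, C1, s, q) / D (C0, C1, s, q)) (at 1)"
    using generic_near_q1[of _ H "(A0, A1, t, 1)", OF N(3)] nz by auto
  then have s': "s \<noteq> 0" "s \<noteq> 1"
    by (auto simp: H_def)
  have "((\<lambda>q. F (C0, C1, s, q) * D (C0, C1, s, q)) \<longlongrightarrow> h C0 C1 s * D (C0, C1, s, 1)) (at 1)"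
    by (intro tendsto_intros lim s' polyfun_tendsto_q1 N)
  moreover have "eventually (\<lambda>q. F (C0, C1, s, q) * D (C0, C1, s, q) = N (C0, C1, s, q)) (at 1)"
    using s(2) by eventually_elim simp
  ultimately have "((\<lambda>q. N (C0, C1, s, q)) \<longlongrightarrow> h C0 C1 s * D (C0, C1, s, 1)) (at 1)"
    using tendsto_cong by fastforce
  then have "N (C0, C1, s, 1) = h C0 C1 s * D (C0, C1, s, 1)"
    using polyfun_tendsto_q1[OF N(1)] tendsto_unique trivial_limit_at by blast
  then show False
    using s(1) H_eq[OF s'] by simp
qed

text \<open>With a finite index type there are finitely many entries, whose regular denominators
  have a common nonzero on \<open>q = 1\<close>. The function \<open>K\<close> is \<open>h\<close>
  cleared of its poles at \<open>t = 0\<close> and \<open>t = 1\<close>.\<close>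

lemma discretizesI:
  fixes f :: "'k \<Rightarrow> mat2 \<Rightarrow> mat2 \<Rightarrow> complex \<Rightarrow> complex \<Rightarrow> mat2"
  assumes fin: "finite (UNIV :: 'k set)"
    and rat: "\<And>k. rational_mat (\<lambda>p. f k (pt_A0 p) (pt_A1 p) (pt_t p) (pt_q p))"
    and lim: "\<And>k A0 A1 t. t \<noteq> 0 \<Longrightarrow> t \<noteq> 1 \<Longrightarrow> mnear (f k A0 A1 t) (h k A0 A1 t)"
    and K: "\<And>k i j. polyfun (\<lambda>p. K k p $ i $ j)"
      "\<And>k A0 A1 t. t \<noteq> 0 \<Longrightarrow> t \<noteq> 1 \<Longrightarrow> (t * (t - 1)) *\<^sub>m h k A0 A1 t = K k (A0, A1, t, 1)"
  shows "discretizes f h"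
proof -
  define F where "F = (\<lambda>k i j (A0, A1, t, q). f k A0 A1 t q $ i $ j)"
  have F_rat: "rational_fun (F k i j)" for k i j
    using rat[of k] by (simp add: F_def rational_mat_def case_prod_unfold)
  have F_lim: "((\<lambda>q. F k i j (A0, A1, t, q)) \<longlongrightarrow> h k A0 A1 t $ i $ j) (at 1)"
    if "t \<noteq> 0" "t \<noteq> 1" for k i j A0 A1 t
    using lim[OF that] by (simp add: F_def mnear_iff near_tendsto)
  have "\<exists>N D b. represents N D (F (fst x) (fst (snd x)) (snd (snd x))) \<and> D b \<noteq> 0 \<and> pt_q b = 1"
    for x :: "'k \<times> 2 \<times> 2"
    by (rule represents_regular_at_q1[OF F_rat]) (use F_lim in blast)
  then obtain N D where ND: "\<And>x. represents (N x) (D x) (F (fst x) (fst (snd x)) (snd (snd x)))"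
    "\<And>x. \<exists>b. D x b \<noteq> 0 \<and> pt_q b = 1"
    by metis
  have "finite (UNIV :: ('k \<times> 2 \<times> 2) set)"
    using fin by (simp add: finite_prod)
  then obtain b where b: "pt_q b = 1" "\<And>x. D x b \<noteq> 0"
    using common_nonzero_at_q1[of UNIV D] ND unfolding represents_iff by blast
  have "b \<notin> polar_locus (F k i j)" for k i j
    using ND(1)[of "(k, i, j)"] b(2)[of "(k, i, j)"] unfolding polar_locus_def by auto
  then have not_polar: "\<not> {(A0, A1, t, q). q = 1} \<subseteq> (\<Union>k i j. polar_locus (F k i j))"
    using b(1) by (auto simp: case_prod_unfold)
  have value_at_q1: "h k A0 A1 t $ i $ j = N (A0, A1, t, 1) / D (A0, A1, t, 1)"
    if "t \<noteq> 0" "t \<noteq> 1" "represents N D (F k i j)" "D (A0, A1, t, 1) \<noteq> 0" for k i j A0 A1 t N D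
  proof -
    have cleared: "t * (t - 1) * h k A0 A1 t $ i $ j = K k (A0, A1, t, 1) $ i $ j"
      if "t \<noteq> 0" "t \<noteq> 1" for A0 A1 t
      using K(2)[OF that, of k A0 A1] smult_mat_nth[of "t * (t - 1)" "h k A0 A1 t" i j] by simp
    show ?thesis
      by (rule represents_value_at_q1[where h = "\<lambda>A0 A1 t. h k A0 A1 t $ i $ j"
          and K = "\<lambda>p. K k p $ i $ j", OF that(3,4,1,2) _ K(1)])
         (rule F_lim cleared; assumption)+
  qed
  show ?thesis
    unfolding discretizes_def F_def[symmetric] unfolding Let_def
    by (intro conjI allI impI F_rat not_polar) (rule value_at_q1)
qed

section \<open>Rationality of the q-Schlesinger system and its restriction to
  \<open>q = 1\<close>\<close>

context theta_asymptotics
begin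

abbreviation "at_point f p \<equiv> f (pt_A0 p) (pt_A1 p) (pt_t p) (pt_q p)"

lemma rational_qA_inf: "rational_mat (\<lambda>p. qA_inf \<Theta>inf (pt_q p))"
  unfolding qA_inf_def by (intro rational_intros)

lemma rational_qquad: "rational_fun S \<Longrightarrow> rational_fun (\<lambda>p. qquad \<Theta>t (S p) (pt_q p))"
  unfolding qquad_def by (intro rational_intros)

lemma rational_B0: "rational_mat (\<lambda>p. at_point (B0 \<Theta>t \<Theta>inf) p)"
proof -
  have "eventually (\<lambda>q. det (mat 1 + (q - 1) *\<^sub>m (A0 + (t * (t - 1) / qquad \<Theta>t t q) *\<^sub>m A1)) \<noteq> 0) (at 1)"
    if "t \<noteq> 0" "t \<noteq> 1" for A0 A1 t
    using mnear_eventually_det[OF near_Y[OF that]] by (simp add: Q_def[OF that])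
  then show ?thesis
    unfolding B0_def
    by (intro rational_intros rational_qA_inf rational_qquad rational_mat_matrix_inv) simp_all
qed

lemma det_neg_mat: "det (- mat c :: mat2) = c ^ 2"
  by (simp add: det_2 mat_nth power2_eq_square)

lemma rational_inverse_B0: "rational_mat (\<lambda>p. matrix_inv (at_point (B0 \<Theta>t \<Theta>inf) p))"
  by (intro rational_mat_matrix_inv rational_B0)
     (simp add: mnear_eventually_det[OF near_B0] det_neg_mat)

lemma rational_inverse_mat_1_plus_B0:
  "rational_mat (\<lambda>p. matrix_inv (mat 1 + at_point (B0 \<Theta>t \<Theta>inf) p))"
proof (intro rational_mat_matrix_inv rational_intros rational_B0)
  fix A0 A1 t assume t: "t \<noteq> (0::complex)" "t \<noteq> 1"
  have "det (mat 1 + - mat t :: mat2) \<noteq> 0"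
    using t by (simp add: det_2 mat_nth)
  then show "eventually (\<lambda>q. det (mat 1 + at_point (B0 \<Theta>t \<Theta>inf) (A0, A1, t, q)) \<noteq> 0) (at 1)"
    using mnear_eventually_det[OF mnear_add[OF mnear_const[of "mat 1"] near_B0[OF t]]] by simp
qed

lemma rational_qschlesinger: "rational_mat (\<lambda>p. at_point (qschlesinger \<Theta>t \<Theta>inf k) p)"
  by (cases k)
     (simp_all add: qschlesinger_0_def qschlesinger_1_def qschlesinger_t_def Let_def qA_t_def rational_intros
       rational_B0 rational_inverse_B0 rational_inverse_mat_1_plus_B0 rational_qquad rational_qA_inf)

text \<open>The polynomial numerators over the common denominator \<open>t (t - 1)\<close>, serving
  as \<open>K\<close> in \<open>discretizesI\<close>.\<close>

fun schlesinger_cleared :: "residue \<Rightarrow> point \<Rightarrow> mat2" where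
  "schlesinger_cleared Res_0 p =
     (1 - pt_t p) *\<^sub>m commutator (pt_A0 p) (A_t \<theta>inf (pt_A0 p) (pt_A1 p))"
| "schlesinger_cleared Res_1 p =
     (- pt_t p) *\<^sub>m commutator (pt_A1 p) (A_t \<theta>inf (pt_A0 p) (pt_A1 p))"
| "schlesinger_cleared Res_t p =
     - ((1 - pt_t p) *\<^sub>m commutator (pt_A0 p) (A_t \<theta>inf (pt_A0 p) (pt_A1 p)))
     - (- pt_t p) *\<^sub>m commutator (pt_A1 p) (A_t \<theta>inf (pt_A0 p) (pt_A1 p))"

lemma polyfun_commutator:
  "(\<And>i j. polyfun (\<lambda>p. M p $ i $ j)) \<Longrightarrow> (\<And>i j. polyfun (\<lambda>p. N p $ i $ j)) \<Longrightarrow>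
    polyfun (\<lambda>p. commutator (M p) (N p) $ i $ j)"
  by (simp add: commutator_def mat2_mult_nth polyfun_intros)

lemma polyfun_A_t: "polyfun (\<lambda>p. A_t \<theta>inf (pt_A0 p) (pt_A1 p) $ i $ j)"
  by (simp add: A_t_def polyfun_intros)

lemma polyfun_schlesinger_cleared: "polyfun (\<lambda>p. schlesinger_cleared k p $ i $ j)"
  by (cases k) (simp_all add: polyfun_intros polyfun_commutator polyfun_A_t)

lemma schlesinger_cleared:
  assumes "t \<noteq> 0" "t \<noteq> 1"
  shows "(t * (t - 1)) *\<^sub>m schlesinger k A0 A1 (A_t \<theta>inf A0 A1) t = schlesinger_cleared k (A0, A1, t, 1)"
proof -
  have "t * (t - 1) * (1 / (0 - t)) = 1 - t" "t * (t - 1) * (1 / (1 - t)) = - t"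
    using assms by (simp_all add: field_simps)
  then show ?thesis
    by (cases k) (simp_all only: schlesinger.simps schlesinger_cleared.simps schlesinger_0_def
      schlesinger_1_def schlesinger_t_def smult_mat_algebra smult_mat_uminus fst_conv snd_conv)
qed

lemma discretizes_qschlesinger:
  "discretizes (qschlesinger \<Theta>t \<Theta>inf) (\<lambda>k A0 A1 t. schlesinger k A0 A1 (A_t \<theta>inf A0 A1) t)"
proof (rule discretizesI)
  have "(UNIV :: residue set) = {Res_0, Res_1, Res_t}"
    using residue.exhaust by auto
  then show "finite (UNIV :: residue set)"
    by (metis finite.simps)
qed (auto intro: rational_qschlesinger near_qschlesinger polyfun_schlesinger_cleared schlesinger_cleared)

end

theorem mainTheorem6:
  fixes \<theta>0 \<theta>1 \<theta>t \<theta>inf :: complex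
    and \<Theta>0 \<Theta>1 \<Theta>t \<Theta>inf :: "complex poly fract"
  assumes "(\<lambda>q. rat_eval \<Theta>0 q - (1 + (q - 1) * (\<theta>0 / 2))) \<in> O[at 1](\<lambda>q. (q - 1)^2)"
    and "(\<lambda>q. rat_eval \<Theta>1 q - (1 + (q - 1) * (\<theta>1 / 2))) \<in> O[at 1](\<lambda>q. (q - 1)^2)"
    and "(\<lambda>q. rat_eval \<Theta>t q - (1 + (q - 1) * (\<theta>t / 2))) \<in> O[at 1](\<lambda>q. (q - 1)^2)"
    and "(\<lambda>q. rat_eval \<Theta>inf q - (1 + (q - 1) * (\<theta>inf / 2))) \<in> O[at 1](\<lambda>q. (q - 1)^2)"
  shows "discretizes (qschlesinger \<Theta>t \<Theta>inf) (\<lambda>k A0 A1 t. schlesinger k A0 A1 (A_t \<theta>inf A0 A1) t) \<and>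
    (\<forall>A0 A1 t. t \<noteq> 0 \<longrightarrow> t \<noteq> 1 \<longrightarrow>
       eq_up_to_O (qschlesinger_0 \<Theta>t \<Theta>inf A0 A1 t)
         (\<lambda>q. schlesinger_0 A0 (qA_t \<Theta>inf A0 A1 q) t) \<and>
       eq_up_to_O (qschlesinger_1 \<Theta>t \<Theta>inf A0 A1 t)
         (\<lambda>q. schlesinger_1 A1 (qA_t \<Theta>inf A0 A1 q) t) \<and>
       eq_up_to_O (qschlesinger_t \<Theta>t \<Theta>inf A0 A1 t)
         (\<lambda>q. schlesinger_t A0 A1 (qA_t \<Theta>inf A0 A1 q) t))"
proof -
  interpret theta_asymptotics \<theta>t \<theta>inf \<Theta>t \<Theta>inf
    by unfold_locales (use assms in auto)
  show ?thesis
  proof (intro conjI allI impI)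
    show "discretizes (qschlesinger \<Theta>t \<Theta>inf) (\<lambda>k A0 A1 t. schlesinger k A0 A1 (A_t \<theta>inf A0 A1) t)"
      by (rule discretizes_qschlesinger)
    fix A0 A1 :: mat2 and t :: complex
    assume t: "t \<noteq> 0" "t \<noteq> 1"
    \<comment> \<open>The comparison side contains \<open>qA_t\<close> at \<open>q\<close> instead
      of its limit. With \<open>commutator\<close> unfolded, the closure rules and
      \<open>near_qA_t\<close> show that it has the same limit at the same rate.\<close>
    show "eq_up_to_O (qschlesinger_0 \<Theta>t \<Theta>inf A0 A1 t) (\<lambda>q. schlesinger_0 A0 (qA_t \<Theta>inf A0 A1 q) t)"
      unfolding schlesinger_0_def commutator_def
      by (intro mnear_imp_eq_up_to_O[OF near_qschlesinger_0[OF t, unfolded schlesinger_0_def commutator_def]]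
          near_intros near_qA_t)
    show "eq_up_to_O (qschlesinger_1 \<Theta>t \<Theta>inf A0 A1 t) (\<lambda>q. schlesinger_1 A1 (qA_t \<Theta>inf A0 A1 q) t)"
      unfolding schlesinger_1_def commutator_def
      by (intro mnear_imp_eq_up_to_O[OF near_qschlesinger_1[OF t, unfolded schlesinger_1_def commutator_def]]
          near_intros near_qA_t)
    show "eq_up_to_O (qschlesinger_t \<Theta>t \<Theta>inf A0 A1 t) (\<lambda>q. schlesinger_t A0 A1 (qA_t \<Theta>inf A0 A1 q) t)"
      unfolding schlesinger_t_def commutator_def
      by (intro mnear_imp_eq_up_to_O[OF near_qschlesinger_t[OF t, unfolded schlesinger_t_def commutator_def]]
          near_intros near_qA_t)
  qed
qed

end
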